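(* Let $\mathcal{A}$ be a bridge-alterable class of graphs, let $n$ be a positive integer such that $\mathcal{A}_n$ is non-empty, let $R_n$ be a uniformly random element of $\mathcal{A}_n$, and for each $t = 1, 2, \ldots$ let $F_t$ be a uniformly random element of $\mathcal{F}_t$. Let $\alpha = 0.4$. Then $$\mathbb{P}(R_n \text{ is connected}) \;\geq\; \min_{\alpha n \leq t \leq n} \mathbb{P}(F_t \text{ is connected}),$$ where the minimum is over integers $t$ with $\alpha n \le t \le n$.
   Context: Graphs are finite, simple and labelled. A bridge of a graph is an edge whose deletion increases the number of connected components. A class (collection) $\mathcal{A}$ of graphs is called bridge-alterable if, for each graph $G$ and each bridge $e$ of $G$, $G \in \mathcal{A}$ if and only if $G - e \in \mathcal{A}$ (where $G-e$ is $G$ with the edge $e$ deleted, same vertex set). Equivalently, $\mathcal{A}$ is closed under adding an edge between two vertices in different components and closed under deleting bridges. For a class $\mathcal{A}$ and a positive integer $n$, $\mathcal{A}_n$ denotes the set of graphs in $\mathcal{A}$ with vertex set $[n] = \{1,\ldots,n\}$. $\mathcal{F}$ denotes the class of all forests (acyclic graphs), so $\mathcal{F}_t$ is the set of all forests on vertex set $\{1,\ldots,t\}$. *)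

theory Defs
  imports
    "HOL-Probability.Probability_Mass_Function"
    "Graph_Theory.Pair_Digraph"
    "Graph_Theory.Digraph_Component"
begin

text \<open>
  A finite simple labelled graph is an element of \<open>'a pair_pre_digraph\<close> satisfying
  \<^const>\<open>pair_graph\<close> (finite, loop-free, symmetric arc relation). An undirected edge \<open>uv\<close>
  is the pair of arcs \<open>(u,v)\<close> and \<open>(v,u)\<close>, so graphs on a fixed vertex set correspond
  one-to-one to sets of two-element subsets of it. Either arc may name the edge, and deleting the
  edge removes both.
\<close>

definition delete_edge :: "'a pair_pre_digraph \<Rightarrow> 'a \<times> 'a \<Rightarrow> 'a pair_pre_digraph" where
  "delete_edge G e = \<lparr>pverts = pverts G, parcs = parcs G - {e, prod.swap e}\<rparr>"

text \<open>The arc relation being symmetric, the strongly connected components are the components.\<close>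

definition num_components :: "'a pair_pre_digraph \<Rightarrow> nat" where
  "num_components G = card (pre_digraph.sccs (with_proj G))"

definition bridge :: "'a pair_pre_digraph \<Rightarrow> 'a \<times> 'a \<Rightarrow> bool" where
  "bridge G e \<longleftrightarrow> e \<in> parcs G \<and> num_components G < num_components (delete_edge G e)"

definition bridge_alterable :: "'a pair_pre_digraph set \<Rightarrow> bool" where
  "bridge_alterable \<A> \<longleftrightarrow>
    (\<forall>G e. pair_graph G \<longrightarrow> bridge G e \<longrightarrow> (G \<in> \<A> \<longleftrightarrow> delete_edge G e \<in> \<A>))"

definition graphs_on :: "nat pair_pre_digraph set \<Rightarrow> nat \<Rightarrow> nat pair_pre_digraph set" where
  "graphs_on \<A> n = {G \<in> \<A>. pverts G = {1..n}}"

text \<open>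
  The library's \<^const>\<open>forest\<close> is not usable here: in a symmetric digraph, traversing an edge
  back and forth is a directed cycle of length 2. The cycles of length at least 3 are exactly the
  cycles of the undirected graph.
\<close>

definition forests :: "nat pair_pre_digraph set" where
  "forests = {G. pair_graph G \<and> \<not> (\<exists>p. pre_digraph.cycle (with_proj G) p \<and> 3 \<le> length p)}"

text \<open>
  \<^const>\<open>pmf_of_set\<close> is the uniform distribution only on finite nonempty sets; finiteness of
  \<^term>\<open>graphs_on \<A> n\<close> is shown below.
\<close>

definition prob_connected :: "nat pair_pre_digraph set \<Rightarrow> real" where
  "prob_connected S =
    measure_pmf.prob (pmf_of_set S) {G. Digraph_Component.connected (with_proj G)}"

lemma finite_graphs_on:
  assumes "\<And>G. G \<in> \<A> \<Longrightarrow> pair_graph G"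
  shows "finite (graphs_on \<A> n)"
proof (rule finite_subset)
  show "graphs_on \<A> n \<subseteq>
      (\<lambda>E. \<lparr>pverts = {1..n}, parcs = E\<rparr>) ` Pow ({1..n} \<times> {1..n})"
  proof
    fix G assume G: "G \<in> graphs_on \<A> n"
    then interpret pair_graph G using assms by (simp add: graphs_on_def)
    have "parcs G \<subseteq> {1..n} \<times> {1..n}"
      using G arc_fst_in_verts arc_snd_in_verts by (force simp: graphs_on_def)
    moreover have "G = \<lparr>pverts = {1..n}, parcs = parcs G\<rparr>"
      using G by (simp add: graphs_on_def)
    ultimately show "G \<in> (\<lambda>E. \<lparr>pverts = {1..n}, parcs = E\<rparr>) ` Pow ({1..n} \<times> {1..n})"
      by blast
  qed
qed simp

lemma finite_forests_on: "finite (graphs_on forests t)"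
  by (rule finite_graphs_on) (simp add: forests_def)

lemma forests_on_nonempty: "graphs_on forests t \<noteq> {}"
proof -
  let ?G = "\<lparr>pverts = {1..t}, parcs = {}\<rparr> :: nat pair_pre_digraph"
  have "pair_graph ?G"
    by unfold_locales (auto simp: Digraph.symmetric_def arcs_ends_def with_proj_def sym_def)
  moreover have "\<not> pre_digraph.cycle (with_proj ?G) p" for p
    by (auto simp: pre_digraph.cycle_def pre_digraph.awalk_def with_proj_def)
  ultimately have "?G \<in> graphs_on forests t"
    by (simp add: graphs_on_def forests_def)
  then show ?thesis by blast
qed

end

theory Submission
  imports Defs
begin

text \<open>
  Deleting all bridges of a graph (its \<open>core\<close>) splits the class on a vertex set \<open>V\<close> of size \<open>n\<close>
  into blocks: the block of a bridgeless \<open>H\<close> consists of all graphs obtained from \<open>H\<close> by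
  successively joining different components. It suffices to bound the ratio
  (size of the block) / (number of its connected members) for each \<open>H\<close>. If \<open>H\<close> has \<open>k\<close> components
  with vertex sets \<open>A\<close>, then the members of the block whose partition into components is \<open>C\<close> number
  \<open>\<Prod>\<^sub>A |A| \<cdot> \<Prod>\<^sub>D |D|^(k\<^sub>D - 2)\<close>, where \<open>D\<close> ranges over \<open>C\<close> and \<open>k\<^sub>D\<close> counts the
  components of \<open>H\<close> inside \<open>D\<close>.

  Relative to the connected members, Gibbs' inequality and \<open>|D| \<ge> k\<^sub>D\<close> show that each of these terms is
  at most the corresponding one for \<open>k\<close> isolated vertices, so the ratio is at most that of the
  forests on \<open>k\<close> vertices. This settles \<open>k \<ge> 0.4 n\<close>. For \<open>k < 0.4 n\<close>, double counting the
  ways to add and to delete a bridge gives the ratio \<open>\<le> exp (k / n) < 3 / 2\<close>, whereas the forests on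
  \<open>n\<close> vertices have ratio \<open>\<ge> 3 / 2\<close>, counting only those with one or two components.
\<close>

section \<open>Graphs as arc relations and their bridge extensions\<close>

text \<open>The probability that \<open>R_n\<close> is connected is the average of the corresponding
  probabilities in the blocks, weighted by block size, so a bound that holds in each block passes to
  the class. The forests on \<open>t\<close> vertices are themselves a block, that of the edgeless
  graph. Both exact counts used (for a prescribed partition and for two components) come from one
  double counting of pairs (extension, new arc): the number of new arcs depends only on the number
  of components, so the double counting is a recursion, and a closed form need only be checked
  against it. The obstacle is that for \<open>k < 0.4 n\<close> the comparison with \<open>k\<close>
  isolated vertices leads to a \<open>t\<close> outside the range of the minimum, so
  \<open>t = n\<close> has to serve. Counting forests with one or two components gives the ratio
  \<open>1 + (1 - (n - 2) (n - 3) / (2 n^2))\<close>, which tends to \<open>3 / 2\<close>. Since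
  \<open>ln (3 / 2) = 0.405...\<close>, the constant \<open>0.4\<close> is close to the largest
  threshold that this truncation permits.\<close>

definition simple_arcs :: "'a set \<Rightarrow> 'a rel set" where
  "simple_arcs V = {E. E \<subseteq> V \<times> V \<and> sym E \<and> irrefl E}"

definition add_edge :: "'a rel \<Rightarrow> 'a \<Rightarrow> 'a \<Rightarrow> 'a rel" where
  "add_edge E u v = E \<union> {(u, v), (v, u)}"

definition cls :: "'a rel \<Rightarrow> 'a \<Rightarrow> 'a set" where
  "cls E u = E\<^sup>* `` {u}"

definition comps :: "'a set \<Rightarrow> 'a rel \<Rightarrow> 'a set set" where
  "comps V E = cls E ` V"

text \<open>
  Each edge consists of two arcs and lowers the number of components by at most one. Equality below
  says that every edge added to \<open>H\<close> joins two different components, in whatever order the edges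
  are added.
\<close>

definition bridge_exts :: "'a set \<Rightarrow> 'a rel \<Rightarrow> 'a rel set" where
  "bridge_exts V H = {E \<in> simple_arcs V. H \<subseteq> E \<and>
     card (E - H) + 2 * card (comps V E) = 2 * card (comps V H)}"

lemma simple_arcsD:
  assumes "E \<in> simple_arcs V"
  shows "E \<subseteq> V \<times> V" "sym E" "irrefl E"
  using assms by (auto simp: simple_arcs_def)

lemma finite_simple_arcs: "finite V \<Longrightarrow> finite (simple_arcs V)"
  by (rule finite_subset[of _ "Pow (V \<times> V)"]) (auto simp: simple_arcs_def)

lemma finite_arcs: "finite V \<Longrightarrow> E \<in> simple_arcs V \<Longrightarrow> finite E"
  using finite_subset[OF simple_arcsD(1)] by blast

lemma finite_bridge_exts: "finite V \<Longrightarrow> finite (bridge_exts V H)"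
  by (rule finite_subset[OF _ finite_simple_arcs]) (auto simp: bridge_exts_def)

lemma finite_comps: "finite V \<Longrightarrow> finite (comps V E)"
  by (simp add: comps_def)

lemma add_edge_simple:
  "E \<in> simple_arcs V \<Longrightarrow> u \<in> V \<Longrightarrow> v \<in> V \<Longrightarrow> u \<noteq> v \<Longrightarrow> add_edge E u v \<in> simple_arcs V"
  by (auto simp: simple_arcs_def add_edge_def sym_def irrefl_def)

lemma cls_refl [simp]: "u \<in> cls E u"
  by (simp add: cls_def)

lemma mem_cls_iff: "v \<in> cls E u \<longleftrightarrow> (u, v) \<in> E\<^sup>*"
  by (simp add: cls_def)

lemma rtrancl_sym: "sym E \<Longrightarrow> (u, v) \<in> E\<^sup>* \<longleftrightarrow> (v, u) \<in> E\<^sup>*"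
  by (meson sym_rtrancl symD)

lemma cls_eq_iff: "sym E \<Longrightarrow> cls E u = cls E v \<longleftrightarrow> (u, v) \<in> E\<^sup>*"
  unfolding cls_def
  by (auto intro: rtrancl_trans dest: rtrancl_sym[THEN iffD1, rotated])

lemma cls_eqI: "sym E \<Longrightarrow> v \<in> cls E u \<Longrightarrow> cls E v = cls E u"
  using cls_eq_iff mem_cls_iff by metis

lemma cls_subset: "E \<subseteq> V \<times> V \<Longrightarrow> u \<in> V \<Longrightarrow> cls E u \<subseteq> V"
  unfolding cls_def by (auto elim: rtranclE)

lemma cls_mono: "E \<subseteq> F \<Longrightarrow> cls E u \<subseteq> cls F u"
  unfolding cls_def using rtrancl_mono by blast

lemma Union_comps: "E \<subseteq> V \<times> V \<Longrightarrow> \<Union> (comps V E) = V"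
  unfolding comps_def using cls_subset[of E V] cls_refl[of _ E] by blast

lemma comps_nonempty: "A \<in> comps V E \<Longrightarrow> A \<noteq> {}"
  unfolding comps_def by (metis cls_refl empty_iff imageE)

lemma comps_disjoint:
  "sym E \<Longrightarrow> A \<in> comps V E \<Longrightarrow> B \<in> comps V E \<Longrightarrow> x \<in> A \<Longrightarrow> x \<in> B \<Longrightarrow> A = B"
  unfolding comps_def by (metis cls_eqI imageE)

lemma comps_eq_cls: "sym E \<Longrightarrow> A \<in> comps V E \<Longrightarrow> x \<in> A \<Longrightarrow> A = cls E x"
  unfolding comps_def by (metis cls_eqI imageE)

lemma partition_on_comps:
  assumes "E \<in> simple_arcs V" shows "partition_on V (comps V E)"
proof (rule partition_onI)
  show "\<Union> (comps V E) = V" using Union_comps simple_arcsD(1)[OF assms] .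
  show "{} \<notin> comps V E" using comps_nonempty by blast
  show "disjnt p q" if "p \<in> comps V E" "q \<in> comps V E" "p \<noteq> q" for p q
    using comps_disjoint[OF simple_arcsD(2)[OF assms] that(1,2)] that(3) by (auto simp: disjnt_def)
qed

section \<open>Effect of one added edge on the components\<close>

lemma rtrancl_add_edge:
  "(add_edge E u v)\<^sup>* = E\<^sup>* \<union> {(x, y). (x, u) \<in> E\<^sup>* \<and> (v, y) \<in> E\<^sup>*}
    \<union> {(x, y). (x, v) \<in> E\<^sup>* \<and> (u, y) \<in> E\<^sup>*}"
proof -
  have "add_edge E u v = insert (u, v) (insert (v, u) E)"
    by (auto simp: add_edge_def)
  show ?thesis
    unfolding \<open>add_edge E u v = _\<close> rtrancl_insert by (auto intro: rtrancl_trans)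
qed

lemma rtrancl_add_edge_same:
  assumes "sym E" "(u, v) \<in> E\<^sup>*" shows "(add_edge E u v)\<^sup>* = E\<^sup>*"
proof -
  have "(v, u) \<in> E\<^sup>*" using assms rtrancl_sym by metis
  then have "(x, v) \<in> E\<^sup>* \<Longrightarrow> (u, y) \<in> E\<^sup>* \<Longrightarrow> (x, y) \<in> E\<^sup>*"
    "(x, u) \<in> E\<^sup>* \<Longrightarrow> (v, y) \<in> E\<^sup>* \<Longrightarrow> (x, y) \<in> E\<^sup>*" for x y
    using assms(2) by (meson rtrancl_trans)+
  then show ?thesis unfolding rtrancl_add_edge by blast
qed

lemma cls_add_edge:
  assumes "sym E"
  shows "cls (add_edge E u v) w = (if w \<in> cls E u \<union> cls E v then cls E u \<union> cls E v else cls E w)"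
proof -
  have 1: "(x, y) \<in> E\<^sup>* \<longleftrightarrow> (y, x) \<in> E\<^sup>*" for x y using assms rtrancl_sym by metis
  have 2: "(x, y) \<in> E\<^sup>* \<Longrightarrow> (x, z) \<in> E\<^sup>* \<longleftrightarrow> (y, z) \<in> E\<^sup>*" for x y z
    using 1 by (meson rtrancl_trans)
  have "z \<in> cls (add_edge E u v) w \<longleftrightarrow>
      (w, z) \<in> E\<^sup>* \<or> (u, w) \<in> E\<^sup>* \<and> (v, z) \<in> E\<^sup>* \<or> (v, w) \<in> E\<^sup>* \<and> (u, z) \<in> E\<^sup>*" for z
    unfolding cls_def rtrancl_add_edge using 1 by blast
  then show ?thesis using 2[of u w] 2[of v w] by (auto simp: set_eq_iff mem_cls_iff)
qed

lemma comps_add_edge: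
  assumes "sym E" "u \<in> V" "v \<in> V"
  shows "comps V (add_edge E u v) = insert (cls E u \<union> cls E v) (comps V E - {cls E u, cls E v})"
proof -
  have "w \<in> cls E u \<union> cls E v \<longleftrightarrow> cls E w \<in> {cls E u, cls E v}" for w
    using assms(1) cls_eqI cls_refl by (metis UnE UnI1 UnI2 insertE insertI1 insertI2 singletonD)
  then show ?thesis
    using assms unfolding comps_def cls_add_edge[OF assms(1)] by (auto simp: image_iff)
qed

lemma card_comps_add_edge:
  assumes "sym E" "u \<in> V" "v \<in> V" "(u, v) \<notin> E\<^sup>*" "finite V"
  shows "Suc (card (comps V (add_edge E u v))) = card (comps V E)"
proof -
  have ne: "cls E u \<noteq> cls E v" using assms by (simp add: cls_eq_iff)
  have mem: "cls E u \<in> comps V E" "cls E v \<in> comps V E" using assms by (auto simp: comps_def)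
  have "cls E u \<union> cls E v \<notin> comps V E - {cls E u, cls E v}"
    using comps_disjoint[OF assms(1) _ mem(1), of "cls E u \<union> cls E v" u] cls_refl[of u E] by blast
  then have "card (comps V (add_edge E u v)) = Suc (card (comps V E - {cls E u, cls E v}))"
    unfolding comps_add_edge[OF assms(1-3)] using assms(5) by (simp add: finite_comps)
  moreover have "card {cls E u, cls E v} \<le> card (comps V E)"
    using mem assms(5) by (intro card_mono) (auto simp: finite_comps)
  then have "card (comps V E - {cls E u, cls E v}) = card (comps V E) - 2" "2 \<le> card (comps V E)"
    using ne mem assms(5) by (auto simp: card_Diff_subset)
  ultimately show ?thesis by simp
qed

lemma comps_add_edge_same:
  "sym E \<Longrightarrow> (u, v) \<in> E\<^sup>* \<Longrightarrow> comps V (add_edge E u v) = comps V E"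
  by (simp add: comps_def cls_def rtrancl_add_edge_same)

lemma card_comps_add_edge_le:
  assumes "sym E" "u \<in> V" "v \<in> V" "finite V"
  shows "card (comps V E) \<le> Suc (card (comps V (add_edge E u v)))"
  using card_comps_add_edge[of E u V v] comps_add_edge_same[of E u v V] assms
  by (cases "(u, v) \<in> E\<^sup>*") auto

lemma card_Diff_add_edge:
  assumes "finite E" "(u, v) \<in> E" "(v, u) \<in> E" "(u, v) \<notin> H" "(v, u) \<notin> H" "u \<noteq> v"
  shows "card (E - H) = card (E - add_edge H u v) + 2"
proof -
  have "E - H = insert (u, v) (insert (v, u) (E - add_edge H u v))"
    using assms by (auto simp: add_edge_def)
  moreover have "(u, v) \<notin> insert (v, u) (E - add_edge H u v)" "(v, u) \<notin> E - add_edge H u v"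
    using assms(6) by (auto simp: add_edge_def)
  moreover have "finite (E - add_edge H u v)" using assms(1) by simp
  ultimately show ?thesis by (metis add_2_eq_Suc' card_insert_disjoint finite_insert)
qed

text \<open>The edges of \<open>E - H\<close> are added to \<open>H\<close> one at a time; each
  costs two arcs and merges at most two components. The equality case is the condition in
  \<open>bridge_exts\<close>.\<close>

lemma card_comps_le:
  assumes "finite V" "E \<in> simple_arcs V" "H \<in> simple_arcs V" "H \<subseteq> E"
  shows "2 * card (comps V H) \<le> card (E - H) + 2 * card (comps V E)"
  using assms(3,4)
proof (induction "card (E - H)" arbitrary: H rule: less_induct)
  case less
  note E = simple_arcsD[OF assms(2)] and H = simple_arcsD[OF less.prems(1)]
  show ?case
  proof (cases "E = H")
    case False
    then obtain u v where uv: "(u, v) \<in> E" "(u, v) \<notin> H" using less.prems(2) by auto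
    have vu: "(v, u) \<in> E" "(v, u) \<notin> H" using uv E H by (auto dest: symD)
    have ne: "u \<noteq> v" using E uv by (auto simp: irrefl_def)
    have V: "u \<in> V" "v \<in> V" using uv E by auto
    have fin: "finite E" using assms finite_arcs by metis
    have 1: "card (E - H) = card (E - add_edge H u v) + 2"
      using card_Diff_add_edge[OF fin uv(1) vu(1) uv(2) vu(2) ne] .
    have "2 * card (comps V (add_edge H u v)) \<le> card (E - add_edge H u v) + 2 * card (comps V E)"
      using less.hyps[of "add_edge H u v"] 1 add_edge_simple[OF less.prems(1) V ne]
        less.prems(2) uv vu by (auto simp: add_edge_def)
    then show ?thesis using 1 card_comps_add_edge_le[OF H(2) V assms(1)] by simp
  qed simp
qed

lemma bridge_extsD:
  assumes "E \<in> bridge_exts V H"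
  shows "E \<in> simple_arcs V" "H \<subseteq> E" "card (E - H) + 2 * card (comps V E) = 2 * card (comps V H)"
  using assms by (auto simp: bridge_exts_def)

text \<open>If \<open>H\<close> already connected \<open>u\<close> and \<open>v\<close>, adding that
  edge first would spend two arcs without lowering the number of components, and
  \<open>card_comps_le\<close> for the remaining arcs would contradict the equality in
  \<open>bridge_exts\<close>.\<close>

lemma bridge_exts_new_arc:
  assumes "finite V" "H \<in> simple_arcs V" "E \<in> bridge_exts V H" "(u, v) \<in> E - H"
  shows "(u, v) \<notin> H\<^sup>*"
proof
  assume c: "(u, v) \<in> H\<^sup>*"
  note X = bridge_extsD[OF assms(3)]
  note E = simple_arcsD[OF X(1)] and H = simple_arcsD[OF assms(2)]
  have vu: "(v, u) \<in> E" "(v, u) \<notin> H" using assms(4) E H by (auto dest: symD)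
  have ne: "u \<noteq> v" using E assms(4) by (auto simp: irrefl_def)
  have V: "u \<in> V" "v \<in> V" using assms(4) E by auto
  have "card (E - H) = card (E - add_edge H u v) + 2"
    using card_Diff_add_edge[OF finite_arcs[OF assms(1) X(1)] _ vu(1) _ vu(2) ne] assms(4) by auto
  moreover have "2 * card (comps V (add_edge H u v)) \<le> card (E - add_edge H u v) + 2 * card (comps V E)"
    using card_comps_le[OF assms(1) X(1) add_edge_simple[OF assms(2) V ne]] X(2) assms(4) vu
    by (auto simp: add_edge_def)
  ultimately show False using X(3) comps_add_edge_same[OF H(2) c, of V] by simp
qed

text \<open>Passing from \<open>H\<close> to \<open>add_edge H u v\<close> takes two arcs from
  \<open>E - H\<close> and one component from \<open>H\<close>, so the defining equality is
  preserved.\<close>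

lemma bridge_exts_add_edge:
  assumes "finite V" "H \<in> simple_arcs V" "u \<in> V" "v \<in> V" "(u, v) \<notin> H\<^sup>*"
  shows "bridge_exts V (add_edge H u v) = {E \<in> bridge_exts V H. (u, v) \<in> E - H}"
proof -
  note H = simple_arcsD[OF assms(2)]
  have uvH: "(u, v) \<notin> H" "(v, u) \<notin> H" using assms(5) H by (auto dest: symD)
  have ne: "u \<noteq> v" using assms(5) by auto
  have c: "Suc (card (comps V (add_edge H u v))) = card (comps V H)"
    using card_comps_add_edge[OF H(2) assms(3,4,5,1)] .
  have "E \<in> bridge_exts V (add_edge H u v) \<longleftrightarrow> E \<in> bridge_exts V H \<and> (u, v) \<in> E - H" for E
  proof (cases "E \<in> simple_arcs V \<and> H \<subseteq> E \<and> (u, v) \<in> E")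
    case True
    note E = simple_arcsD[of E V]
    have vu: "(v, u) \<in> E" using True E by (auto dest: symD)
    have "card (E - H) = card (E - add_edge H u v) + 2"
      using card_Diff_add_edge[OF finite_arcs[OF assms(1)] _ vu uvH ne] True by auto
    then show ?thesis using True vu uvH c by (auto simp: bridge_exts_def add_edge_def)
  qed (auto simp: bridge_exts_def add_edge_def)
  then show ?thesis by blast
qed

text \<open>Both sides count pairs of an extension \<open>E\<close> in \<open>X\<close> and an arc
  of \<open>E - H\<close>. When \<open>X\<close> prescribes the partition into components or their
  number, \<open>card (E - H)\<close> is constant on the left, and the identity becomes a recursion
  on the number of components of \<open>H\<close>.\<close>

lemma bridge_exts_recursion:
  assumes "finite V" "H \<in> simple_arcs V"
  shows "(\<Sum>E \<in> bridge_exts V H \<inter> X. card (E - H)) =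
    (\<Sum>(u, v) \<in> V \<times> V - H\<^sup>*. card (bridge_exts V (add_edge H u v) \<inter> X))"
proof -
  let ?S = "bridge_exts V H \<inter> X"
  have fS: "finite ?S" using finite_bridge_exts[OF assms(1)] by auto
  have eq: "E - H = {a \<in> V \<times> V - H\<^sup>*. a \<in> E - H}" if "E \<in> ?S" for E
  proof -
    have "E \<subseteq> V \<times> V" using that bridge_extsD(1) simple_arcsD(1) by blast
    then show ?thesis using bridge_exts_new_arc[OF assms, of E] that by auto
  qed
  have "(\<Sum>E \<in> ?S. card (E - H)) = (\<Sum>E \<in> ?S. \<Sum>a \<in> V \<times> V - H\<^sup>*. if a \<in> E - H then 1 else 0)"
  proof (rule sum.cong)
    fix E assume E: "E \<in> ?S"
    have "(\<Sum>a \<in> V \<times> V - H\<^sup>*. if a \<in> E - H then 1 else 0) = card ({a \<in> V \<times> V - H\<^sup>*. a \<in> E - H})"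
      using assms(1) by (simp flip: sum.inter_filter)
    then show "card (E - H) = (\<Sum>a \<in> V \<times> V - H\<^sup>*. if a \<in> E - H then 1 else 0)"
      using eq[OF E] by simp
  qed simp
  also have "\<dots> = (\<Sum>a \<in> V \<times> V - H\<^sup>*. \<Sum>E \<in> ?S. if a \<in> E - H then 1 else 0)"
    by (rule sum.swap)
  also have "\<dots> = (\<Sum>(u, v) \<in> V \<times> V - H\<^sup>*. card (bridge_exts V (add_edge H u v) \<inter> X))"
  proof (rule sum.cong)
    fix a assume a: "a \<in> V \<times> V - H\<^sup>*"
    obtain u v where uv: "a = (u, v)" by fastforce
    have "bridge_exts V (add_edge H u v) \<inter> X = {E \<in> ?S. a \<in> E - H}"
      using bridge_exts_add_edge[OF assms, of u v] a uv by auto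
    moreover have "(\<Sum>E \<in> ?S. if a \<in> E - H then 1 else 0) = card {E \<in> ?S. a \<in> E - H}"
      using fS by (simp flip: sum.inter_filter)
    ultimately show "(\<Sum>E \<in> ?S. if a \<in> E - H then 1 else 0) =
        (case a of (u, v) \<Rightarrow> card (bridge_exts V (add_edge H u v) \<inter> X))"
      using uv by simp
  qed simp
  finally show ?thesis .
qed

section \<open>Weights of coarsened partitions\<close>

lemma finite_cls: "finite V \<Longrightarrow> E \<in> simple_arcs V \<Longrightarrow> u \<in> V \<Longrightarrow> finite (cls E u)"
  by (rule finite_subset[OF cls_subset[OF simple_arcsD(1)]])

lemma card_cls_pos: "finite V \<Longrightarrow> E \<in> simple_arcs V \<Longrightarrow> u \<in> V \<Longrightarrow> 0 < card (cls E u)"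
  using finite_cls[of V E u] cls_refl[of u E] by (auto simp: card_gt_0_iff simp del: cls_refl)

text \<open>The value of a component is spread evenly over its vertices. This makes sums over
  components compatible with sums over arcs \<open>(u, v)\<close>, which is how the recursion
  presents them.\<close>

lemma sum_over_comps:
  fixes g :: "'a set \<Rightarrow> real"
  assumes "finite V" "E \<in> simple_arcs V" "D \<subseteq> V" "\<And>u. u \<in> D \<Longrightarrow> cls E u \<subseteq> D"
  shows "(\<Sum>A \<in> {A \<in> comps V E. A \<subseteq> D}. g A) = (\<Sum>u\<in>D. g (cls E u) / card (cls E u))"
proof -
  let ?P = "{A \<in> comps V E. A \<subseteq> D}"
  note E = simple_arcsD[OF assms(2)]
  have U: "\<Union> ?P = D"
    using assms(3,4) cls_refl[of _ E] unfolding comps_def by blast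
  have finP: "\<forall>A\<in>?P. finite A" using finite_subset[OF _ finite_subset[OF assms(3,1)]] by blast
  have disj: "\<forall>A\<in>?P. \<forall>B\<in>?P. A \<noteq> B \<longrightarrow> A \<inter> B = {}"
    using comps_disjoint[OF E(2), of _ V] by (metis (no_types, lifting) disjoint_iff mem_Collect_eq)
  have "(\<Sum>u\<in>D. g (cls E u) / card (cls E u)) = (\<Sum>A\<in>?P. \<Sum>u\<in>A. g (cls E u) / card (cls E u))"
    using sum.Union_disjoint[OF finP disj, of "\<lambda>u. g (cls E u) / card (cls E u)"] U by simp
  also have "\<dots> = (\<Sum>A\<in>?P. g A)"
  proof (rule sum.cong)
    fix A assume A: "A \<in> ?P"
    have "cls E u = A" if "u \<in> A" for u using comps_eq_cls[OF E(2), of A V u] A that by auto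
    then have "(\<Sum>u\<in>A. g (cls E u) / card (cls E u)) = (\<Sum>u\<in>A. g A / card A)" by simp
    also have "A \<noteq> {}" "finite A" using A comps_nonempty finP by blast+
    then have "(\<Sum>u\<in>A. g A / card A) = g A" by simp
    finally show "(\<Sum>u\<in>A. g (cls E u) / card (cls E u)) = g A" .
  qed simp
  finally show ?thesis ..
qed

lemma sum_pairs_fst:
  fixes g :: "'a \<Rightarrow> real"
  assumes "finite D" "\<And>u. u \<in> D \<Longrightarrow> cls E u \<subseteq> D"
  shows "(\<Sum>(u, v) \<in> D \<times> D - E\<^sup>*. g u) = (\<Sum>u\<in>D. g u * (real (card D) - real (card (cls E u))))"
proof -
  have "D \<times> D - E\<^sup>* = (SIGMA u:D. D - cls E u)" by (auto simp: cls_def)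
  then have "(\<Sum>(u, v) \<in> D \<times> D - E\<^sup>*. g u) = (\<Sum>u\<in>D. \<Sum>v\<in>D - cls E u. g u)"
    using assms(1) sum.Sigma[of D "\<lambda>u. D - cls E u" "\<lambda>u v. g u"] by simp
  also have "\<dots> = (\<Sum>u\<in>D. g u * (real (card D) - real (card (cls E u))))"
  proof (rule sum.cong)
    fix u assume u: "u \<in> D"
    have "card (D - cls E u) = card D - card (cls E u)" "card (cls E u) \<le> card D"
      using assms u by (auto intro: card_Diff_subset card_mono finite_subset)
    then show "(\<Sum>v\<in>D - cls E u. g u) = g u * (real (card D) - real (card (cls E u)))"
      by (simp add: of_nat_diff)
  qed simp
  finally show ?thesis .
qed

lemma sum_pairs_snd:
  assumes "sym E"
  shows "(\<Sum>(u, v) \<in> D \<times> D - E\<^sup>*. g v) = (\<Sum>(u, v) \<in> D \<times> D - E\<^sup>*. g u)"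
  by (rule sum.reindex_bij_witness[where i = prod.swap and j = prod.swap])
    (auto simp: rtrancl_sym[OF assms])

text \<open>
  Written with \<open>|D|^k / |D|\<^sup>2\<close> instead of \<open>|D|^(k - 2)\<close>, since the exponent is \<open>-1\<close> for \<open>k = 1\<close>.
\<close>

definition coarse_weight :: "'a set set \<Rightarrow> 'a set set \<Rightarrow> real" where
  "coarse_weight P C = (\<Prod>A\<in>P. real (card A)) *
     (\<Prod>D\<in>C. real (card D) ^ card {A \<in> P. A \<subseteq> D} / (real (card D))\<^sup>2)"

lemma prod_merge:
  fixes f :: "'a set \<Rightarrow> real"
  assumes "finite P" "A \<in> P" "B \<in> P" "A \<noteq> B" "A \<union> B \<notin> P - {A, B}" "f A \<noteq> 0" "f B \<noteq> 0"
  shows "prod f (insert (A \<union> B) (P - {A, B})) = prod f P * f (A \<union> B) / (f A * f B)"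
proof -
  define Q where "Q = P - {A, B}"
  have Q: "finite Q" "A \<notin> insert B Q" "B \<notin> Q" "A \<union> B \<notin> Q"
    using assms(1,4,5) by (auto simp: Q_def)
  have "P = insert A (insert B Q)" using assms(2,3) by (auto simp: Q_def)
  then have "prod f P = f A * (f B * prod f Q)" using Q by simp
  then show ?thesis unfolding Q_def[symmetric] using Q assms(6,7) by simp
qed

text \<open>Replacing the factors \<open>a\<close> and \<open>b\<close> by \<open>a + b\<close>
  multiplies the product of sizes by \<open>(a + b) / (a b) = 1 / a + 1 / b\<close>. The block
  \<open>D\<close> then contains one part fewer, which costs a factor \<open>card D\<close>; the
  other blocks are disjoint from \<open>D\<close> and keep their factors.\<close>

lemma coarse_weight_merge:
  assumes "finite P" "finite C" "A \<in> P" "B \<in> P" "A \<noteq> B" "A \<union> B \<notin> P - {A, B}"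
    and "D \<in> C" "A \<subseteq> D" "B \<subseteq> D" "finite D" "A \<noteq> {}" "B \<noteq> {}" "A \<inter> B = {}"
    and "\<And>D'. D' \<in> C \<Longrightarrow> D' \<noteq> D \<Longrightarrow> D' \<inter> D = {}"
  shows "coarse_weight (insert (A \<union> B) (P - {A, B})) C =
    coarse_weight P C * ((1 / card A + 1 / card B) / card D)"
proof -
  let ?P' = "insert (A \<union> B) (P - {A, B})"
  let ?k = "\<lambda>P D. card {A \<in> P. A \<subseteq> D}"
  let ?g = "\<lambda>P D. real (card D) ^ ?k P D / (real (card D))\<^sup>2"
  have fin: "finite A" "finite B" using assms finite_subset by blast+
  have pos: "0 < card A" "0 < card B" "0 < card D"
    using fin assms by (auto simp: card_gt_0_iff)
  have cU: "card (A \<union> B) = card A + card B" using fin assms by (simp add: card_Un_disjoint)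
  have 1: "(\<Prod>A\<in>?P'. real (card A)) = (\<Prod>A\<in>P. real (card A)) * (1 / card A + 1 / card B)"
    using prod_merge[of P A B "\<lambda>A. real (card A)"] assms pos cU by (simp add: field_simps)
  define Q where "Q = {X \<in> P. X \<subseteq> D} - {A, B}"
  have "{X \<in> P. X \<subseteq> D} = insert A (insert B Q)" "{X \<in> ?P'. X \<subseteq> D} = insert (A \<union> B) Q"
    using assms(3,4,8,9) unfolding Q_def by blast+
  moreover have "A \<union> B \<notin> Q" "A \<notin> insert B Q" "B \<notin> Q" "finite Q"
    using assms(1,5,6) unfolding Q_def by auto
  ultimately have "?k P D = Suc (?k ?P' D)"
    by (metis card_insert_disjoint finite_insert)
  then have 2: "?g ?P' D = ?g P D * (1 / card D)" using pos by simp
  have 3: "?g ?P' D' = ?g P D'" if "D' \<in> C - {D}" for D'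
  proof -
    have "D' \<inter> D = {}" using that assms(14) by auto
    then have "{X \<in> ?P'. X \<subseteq> D'} = {X \<in> P. X \<subseteq> D'}" using assms by blast
    then show ?thesis by simp
  qed
  have "(\<Prod>D\<in>C. ?g ?P' D) = ?g ?P' D * (\<Prod>D\<in>C - {D}. ?g ?P' D)"
    using assms by (simp add: prod.remove)
  also have "(\<Prod>D\<in>C - {D}. ?g ?P' D) = (\<Prod>D\<in>C - {D}. ?g P D)"
    by (rule prod.cong) (use 3 in auto)
  also have "?g ?P' D * (\<Prod>D\<in>C - {D}. ?g P D) = (\<Prod>D\<in>C. ?g P D) * (1 / card D)"
    using assms 2 by (simp add: prod.remove)
  finally show ?thesis unfolding coarse_weight_def 1 by simp
qed

lemma comps_closed:
  assumes "E \<in> simple_arcs V" "partition_on V C" "\<And>A. A \<in> comps V E \<Longrightarrow> \<exists>D\<in>C. A \<subseteq> D"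
    and "D \<in> C" "u \<in> D"
  shows "cls E u \<subseteq> D"
proof -
  have "u \<in> V" using assms(2,4,5) partition_onD1 by fastforce
  then have "cls E u \<in> comps V E" by (simp add: comps_def)
  then obtain D' where D': "D' \<in> C" "cls E u \<subseteq> D'" using assms(3) by blast
  then have "u \<in> D'" using cls_refl[of u E] by blast
  then have "D' = D" using disjointD[OF partition_onD2[OF assms(2)] D'(1) assms(4)] assms(5) by blast
  then show ?thesis using D' by simp
qed

text \<open>Base case of the recursion: each block contributes \<open>d * d / d^2\<close>.\<close>

lemma coarse_weight_self:
  assumes "finite V" "partition_on V C"
  shows "coarse_weight C C = 1"
proof -
  have fin: "finite C" "D \<in> C \<Longrightarrow> finite D" for D
    using finite_elements[OF assms] partition_onD1[OF assms(2)] assms(1)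
    by (auto intro: finite_subset)
  have ne: "D \<in> C \<Longrightarrow> D \<noteq> {}" for D using assms(2) partition_onD3 by blast
  have "{A \<in> C. A \<subseteq> D} = {D}" if "D \<in> C" for D
  proof -
    have "A = D" if "A \<in> C" "A \<subseteq> D" for A
      using that \<open>D \<in> C\<close> ne partition_onD2[OF assms(2)]
      by (metis disjointD inf.absorb1)
    then show ?thesis using that by blast
  qed
  then have "coarse_weight C C = (\<Prod>A\<in>C. real (card A) * (real (card A) ^ 1 / (real (card A))\<^sup>2))"
    unfolding coarse_weight_def prod.distrib by simp
  also have "\<dots> = 1"
  proof (rule prod.neutral, rule ballI)
    fix D assume "D \<in> C"
    then have "card D \<noteq> 0" using fin ne by auto
    then show "real (card D) * (real (card D) ^ 1 / (real (card D))\<^sup>2) = 1"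
      by (simp add: power2_eq_square)
  qed
  finally show ?thesis .
qed

section \<open>Counting extensions with a given partition into components\<close>

lemma coarse_card_blocks:
  assumes "finite V" "E \<in> simple_arcs V" "partition_on V C"
    and "\<And>A. A \<in> comps V E \<Longrightarrow> \<exists>D\<in>C. A \<subseteq> D" "D \<in> C"
  shows "real (card {A \<in> comps V E. A \<subseteq> D}) = (\<Sum>u\<in>D. 1 / card (cls E u))"
proof -
  have "D \<subseteq> V" using assms(3,5) partition_onD1 by blast
  then show ?thesis
    using sum_over_comps[OF assms(1,2), of D "\<lambda>_. 1"] comps_closed[OF assms(2-5)] by simp
qed

lemma sum_coarse_card_blocks:
  assumes "finite V" "E \<in> simple_arcs V" "partition_on V C"
    and "\<And>A. A \<in> comps V E \<Longrightarrow> \<exists>D\<in>C. A \<subseteq> D"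
  shows "(\<Sum>D\<in>C. card {A \<in> comps V E. A \<subseteq> D}) = card (comps V E)"
proof -
  have "comps V E = (\<Union>D\<in>C. {A \<in> comps V E. A \<subseteq> D})" using assms(4) by blast
  also have "card \<dots> = (\<Sum>D\<in>C. card {A \<in> comps V E. A \<subseteq> D})"
  proof (rule card_UN_disjoint)
    show "finite C" using finite_elements[OF assms(1,3)] .
    show "\<forall>D\<in>C. finite {A \<in> comps V E. A \<subseteq> D}" using finite_comps[OF assms(1)] by auto
    show "\<forall>D\<in>C. \<forall>D'\<in>C. D \<noteq> D' \<longrightarrow>
        {A \<in> comps V E. A \<subseteq> D} \<inter> {A \<in> comps V E. A \<subseteq> D'} = {}"
    proof (intro ballI impI)
      fix D D' assume D: "D \<in> C" "D' \<in> C" "D \<noteq> D'"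
      have "D \<inter> D' = {}" using disjointD[OF partition_onD2[OF assms(3)] D] .
      then show "{A \<in> comps V E. A \<subseteq> D} \<inter> {A \<in> comps V E. A \<subseteq> D'} = {}"
        using comps_nonempty[of _ V E] by blast
    qed
  qed
  finally show ?thesis ..
qed

lemma coarse_card_block_pos:
  assumes "finite V" "E \<in> simple_arcs V" "partition_on V C"
    and "\<And>A. A \<in> comps V E \<Longrightarrow> \<exists>D\<in>C. A \<subseteq> D" "D \<in> C"
  shows "0 < card {A \<in> comps V E. A \<subseteq> D}"
proof -
  have "D \<noteq> {}" using assms(3,5) partition_onD3 by blast
  then obtain u where u: "u \<in> D" by blast
  then have "u \<in> V" using assms(3,5) partition_onD1 by blast
  then have "cls E u \<in> {A \<in> comps V E. A \<subseteq> D}"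
    using comps_closed[OF assms(2-5) u] by (simp add: comps_def)
  then show ?thesis using finite_comps[OF assms(1)] by (auto simp: card_gt_0_iff)
qed

text \<open>Every block of \<open>C\<close> contains at least one component, so without strict
  inequality every block would contain exactly one and coincide with it. Strictness is what allows
  the factor \<open>card (comps V H) - card C\<close> to be cancelled from the recursion.\<close>

lemma coarse_card_less:
  assumes "finite V" "E \<in> simple_arcs V" "partition_on V C"
    and "\<And>A. A \<in> comps V E \<Longrightarrow> \<exists>D\<in>C. A \<subseteq> D" "comps V E \<noteq> C"
  shows "card C < card (comps V E)"
proof (rule ccontr)
  assume "\<not> card C < card (comps V E)"
  let ?k = "\<lambda>D. card {A \<in> comps V E. A \<subseteq> D}"
  have finC: "finite C" using finite_elements[OF assms(1,3)] .
  have pos: "1 \<le> ?k D" if "D \<in> C" for D using coarse_card_block_pos[OF assms(1-4) that] by simp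
  have k1: "?k D = 1" if D: "D \<in> C" for D
  proof (rule ccontr)
    assume "?k D \<noteq> 1"
    then have "1 < ?k D" using pos[OF D] by linarith
    then have "(\<Sum>D\<in>C. 1) < (\<Sum>D\<in>C. ?k D)"
      using D finC pos by (intro sum_strict_mono_ex1) auto
    then show False
      using \<open>\<not> card C < card (comps V E)\<close> sum_coarse_card_blocks[OF assms(1-4)] by simp
  qed
  have sub: "C \<subseteq> comps V E"
  proof
    fix D assume D: "D \<in> C"
    obtain A where A: "{A \<in> comps V E. A \<subseteq> D} = {A}" using k1[OF D] card_1_singletonE by blast
    have "cls E u = A" if "u \<in> D" for u
    proof -
      have "u \<in> V" using that assms(3) D partition_onD1 by blast
      then have "cls E u \<in> {A \<in> comps V E. A \<subseteq> D}"
        using comps_closed[OF assms(2-4) D that] by (simp add: comps_def)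
      then show ?thesis using A by blast
    qed
    then have "D \<subseteq> A" using cls_refl by (metis subsetI)
    moreover have "A \<subseteq> D" "A \<in> comps V E" using A by blast+
    ultimately show "D \<in> comps V E" by (metis subset_antisym)
  qed
  have "comps V E \<subseteq> C"
  proof
    fix A assume A: "A \<in> comps V E"
    obtain D where D: "D \<in> C" "A \<subseteq> D" using assms(4)[OF A] by blast
    obtain u where u: "u \<in> A" using comps_nonempty[OF A] by blast
    have "A = D" using comps_disjoint[OF simple_arcsD(2)[OF assms(2)] A _ u, of D] D u sub by blast
    then show "A \<in> C" using D by simp
  qed
  then show False using sub assms(5) by blast
qed

lemma bridge_exts_same_comps:
  assumes "finite V" "H \<in> simple_arcs V"
  shows "{E \<in> bridge_exts V H. card (comps V E) = card (comps V H)} = {H}"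
proof -
  have "E = H" if E: "E \<in> bridge_exts V H" "card (comps V E) = card (comps V H)" for E
  proof -
    have "card (E - H) = 0" using bridge_extsD(3)[OF E(1)] E(2) by simp
    moreover have "finite (E - H)" using finite_arcs[OF assms(1) bridge_extsD(1)[OF E(1)]] by simp
    ultimately show ?thesis using bridge_extsD(2)[OF E(1)] by auto
  qed
  moreover have "H \<in> bridge_exts V H" using assms by (simp add: bridge_exts_def)
  ultimately show ?thesis by blast
qed

text \<open>By symmetry twice the sum over first endpoints. A vertex \<open>u\<close> has
  \<open>card D - card (cls E u)\<close> partners and so contributes
  \<open>card D / card (cls E u) - 1\<close>; the reciprocals add up to the number of components
  inside \<open>D\<close>.\<close>

lemma sum_arcs_inv_card:
  assumes "finite V" "E \<in> simple_arcs V" "partition_on V C"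
    and "\<And>A. A \<in> comps V E \<Longrightarrow> \<exists>D\<in>C. A \<subseteq> D" "D \<in> C"
  shows "(\<Sum>(u, v) \<in> D \<times> D - E\<^sup>*. 1 / card (cls E u) + 1 / card (cls E v)) =
    2 * real (card D) * (real (card {A \<in> comps V E. A \<subseteq> D}) - 1)"
proof -
  let ?g = "\<lambda>u. 1 / real (card (cls E u))"
  have DV: "D \<subseteq> V" using assms(3,5) partition_onD1 by blast
  have finD: "finite D" using DV assms(1) finite_subset by blast
  have "(\<Sum>(u, v) \<in> D \<times> D - E\<^sup>*. ?g u + ?g v) =
      (\<Sum>(u, v) \<in> D \<times> D - E\<^sup>*. ?g u) + (\<Sum>(u, v) \<in> D \<times> D - E\<^sup>*. ?g v)"
    by (simp add: case_prod_unfold sum.distrib)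
  also have "\<dots> = 2 * (\<Sum>(u, v) \<in> D \<times> D - E\<^sup>*. ?g u)"
    using sum_pairs_snd[OF simple_arcsD(2)[OF assms(2)], of ?g D] by simp
  also have "(\<Sum>(u, v) \<in> D \<times> D - E\<^sup>*. ?g u) =
      (\<Sum>u\<in>D. ?g u * (real (card D) - real (card (cls E u))))"
    using sum_pairs_fst[OF finD comps_closed[OF assms(2-5)], of ?g] .
  also have "\<dots> = (\<Sum>u\<in>D. real (card D) * ?g u - 1)"
  proof (rule sum.cong)
    fix u assume "u \<in> D"
    then have "card (cls E u) \<noteq> 0" using card_cls_pos[OF assms(1,2), of u] DV by auto
    then show "?g u * (real (card D) - real (card (cls E u))) = real (card D) * ?g u - 1"
      by (simp add: field_simps)
  qed simp
  also have "\<dots> = real (card D) * (\<Sum>u\<in>D. ?g u) - real (card D)"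
    by (simp add: sum_subtractf sum_distrib_left)
  also have "(\<Sum>u\<in>D. ?g u) = real (card {A \<in> comps V E. A \<subseteq> D})"
    using coarse_card_blocks[OF assms] by simp
  finally show ?thesis by (simp add: algebra_simps)
qed

text \<open>
  Joining components \<open>A\<close> and \<open>B\<close> inside \<open>D\<close> multiplies the weight by
  \<open>(1 / |A| + 1 / |B|) / |D|\<close>, and over all arcs inside \<open>D\<close> these factors add up to \<open>2 (k\<^sub>D - 1)\<close>, so
  the weights satisfy the recursion for the counts.
\<close>

lemma card_bridge_exts_coarse:
  assumes "finite V" "H \<in> simple_arcs V" "partition_on V C"
    and "\<And>A. A \<in> comps V H \<Longrightarrow> \<exists>D\<in>C. A \<subseteq> D"
  shows "real (card {E \<in> bridge_exts V H. comps V E = C}) = coarse_weight (comps V H) C"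
  using assms(2,4)
proof (induction "card (comps V H)" arbitrary: H rule: less_induct)
  case less
  note coarse = less.prems(2)
  let ?P = "comps V H" and ?X = "{E. comps V E = C}"
  let ?f = "\<lambda>H. real (card (bridge_exts V H \<inter> ?X))"
  let ?w = "coarse_weight ?P C"
  have Int: "{E \<in> bridge_exts V H. comps V E = C} = bridge_exts V H \<inter> ?X" for H by blast
  note H = simple_arcsD[OF less.prems(1)]
  have finC: "finite C" using finite_elements[OF assms(1,3)] .
  have DV: "D \<subseteq> V" if "D \<in> C" for D using that assms(3) partition_onD1 by blast
  have finD: "finite D" if "D \<in> C" for D using finite_subset[OF DV[OF that] assms(1)] .
  have disj: "D \<inter> D' = {}" if "D \<in> C" "D' \<in> C" "D \<noteq> D'" for D D'
    using disjointD[OF partition_onD2[OF assms(3)] that] .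
  show ?case
  proof (cases "?P = C")
    case True
    have "{E \<in> bridge_exts V H. comps V E = C} = {H}"
      using bridge_exts_same_comps[OF assms(1) less.prems(1)] True by force
    then show ?thesis using coarse_weight_self[OF assms(1,3)] True by simp
  next
    case False
    have lt: "card C < card ?P"
      using coarse_card_less[OF assms(1) less.prems(1) assms(3) coarse False] .
    have inside: "?f (add_edge H u v) = ?w * ((1 / card (cls H u) + 1 / card (cls H v)) / card D)"
      if D: "D \<in> C" and uv: "(u, v) \<in> D \<times> D - H\<^sup>*" for D u v
    proof -
      have V: "u \<in> V" "v \<in> V" using uv DV[OF D] by auto
      have ne: "u \<noteq> v" using uv by auto
      have sub: "cls H u \<subseteq> D" "cls H v \<subseteq> D"
        using comps_closed[OF less.prems(1) assms(3) coarse D] uv by auto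
      have clsne: "cls H u \<noteq> cls H v" using uv cls_eq_iff[OF H(2)] by auto
      have mem: "cls H u \<in> ?P" "cls H v \<in> ?P" using V by (auto simp: comps_def)
      have disjuv: "cls H u \<inter> cls H v = {}"
        using comps_disjoint[OF H(2) mem] clsne by blast
      have notin: "cls H u \<union> cls H v \<notin> ?P - {cls H u, cls H v}"
        using comps_disjoint[OF H(2) _ mem(1), of "cls H u \<union> cls H v" u] cls_refl[of u H] by blast
      have eq: "comps V (add_edge H u v) = insert (cls H u \<union> cls H v) (?P - {cls H u, cls H v})"
        using comps_add_edge[OF H(2) V] .
      have "real (card {E \<in> bridge_exts V (add_edge H u v). comps V E = C}) =
          coarse_weight (comps V (add_edge H u v)) C"
      proof (rule less.hyps)
        show "card (comps V (add_edge H u v)) < card ?P"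
          using card_comps_add_edge[OF H(2) V _ assms(1)] uv by auto
        show "add_edge H u v \<in> simple_arcs V" using add_edge_simple[OF less.prems(1) V ne] .
        show "\<exists>D\<in>C. A \<subseteq> D" if A: "A \<in> comps V (add_edge H u v)" for A
        proof (cases "A = cls H u \<union> cls H v")
          case True then show ?thesis using D sub by blast
        next
          case False then show ?thesis using A coarse unfolding eq by blast
        qed
      qed
      also have "\<dots> = ?w * ((1 / card (cls H u) + 1 / card (cls H v)) / card D)"
        unfolding eq
      proof (rule coarse_weight_merge[OF finite_comps[OF assms(1)] finC mem clsne notin D sub
            finD[OF D] _ _ disjuv])
        show "cls H u \<noteq> {}" "cls H v \<noteq> {}" using mem comps_nonempty by blast+
        show "D' \<inter> D = {}" if "D' \<in> C" "D' \<noteq> D" for D' using disj[OF that(1) D that(2)] .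
      qed
      finally show ?thesis by (simp only: Int)
    qed
    \<comment> \<open>An extension with this arc has a component containing both endpoints, but no
      block of \<open>C\<close> contains both.\<close>
    have outside: "?f (add_edge H u v) = 0"
      if uv: "(u, v) \<in> V \<times> V - H\<^sup>* - (\<Union>D\<in>C. D \<times> D - H\<^sup>*)" for u v
    proof -
      have "comps V E \<noteq> C" if E: "E \<in> bridge_exts V (add_edge H u v)" for E
      proof
        assume C: "comps V E = C"
        have "(u, v) \<in> E" using bridge_extsD(2)[OF E] by (auto simp: add_edge_def)
        then have "v \<in> cls E u" by (auto simp: cls_def)
        moreover have "cls E u \<in> C" using C uv by (auto simp: comps_def)
        ultimately show False using uv cls_refl[of u E] by blast
      qed
      then have "bridge_exts V (add_edge H u v) \<inter> ?X = {}" by blast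
      then show ?thesis by simp
    qed
    have "(\<Sum>E \<in> bridge_exts V H \<inter> ?X. real (card (E - H))) =
        (\<Sum>(u, v) \<in> V \<times> V - H\<^sup>*. ?f (add_edge H u v))"
      using arg_cong[OF bridge_exts_recursion[OF assms(1) less.prems(1), of ?X], of real]
      by (simp add: case_prod_unfold)
    also have "\<dots> = (\<Sum>(u, v) \<in> (\<Union>D\<in>C. D \<times> D - H\<^sup>*). ?f (add_edge H u v))"
    proof (rule sum.mono_neutral_right)
      show "finite (V \<times> V - H\<^sup>*)" using assms(1) by simp
      show "(\<Union>D\<in>C. D \<times> D - H\<^sup>*) \<subseteq> V \<times> V - H\<^sup>*" using DV by blast
      show "\<forall>a\<in>V \<times> V - H\<^sup>* - (\<Union>D\<in>C. D \<times> D - H\<^sup>*).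
          (case a of (u, v) \<Rightarrow> ?f (add_edge H u v)) = 0"
      proof
        fix a assume a: "a \<in> V \<times> V - H\<^sup>* - (\<Union>D\<in>C. D \<times> D - H\<^sup>*)"
        obtain u v where "a = (u, v)" by fastforce
        then show "(case a of (u, v) \<Rightarrow> ?f (add_edge H u v)) = 0"
          using outside[of u v] a by (simp only: prod.case)
      qed
    qed
    also have "\<dots> = (\<Sum>D\<in>C. \<Sum>(u, v) \<in> D \<times> D - H\<^sup>*. ?f (add_edge H u v))"
    proof (rule sum.UNION_disjoint[OF finC])
      show "\<forall>D\<in>C. finite (D \<times> D - H\<^sup>*)" using finD by simp
      show "\<forall>D\<in>C. \<forall>D'\<in>C. D \<noteq> D' \<longrightarrow> (D \<times> D - H\<^sup>*) \<inter> (D' \<times> D' - H\<^sup>*) = {}"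
        using disj by blast
    qed
    also have "\<dots> = (\<Sum>D\<in>C. ?w * (2 * (real (card {A \<in> ?P. A \<subseteq> D}) - 1)))"
    proof (rule sum.cong)
      fix D assume D: "D \<in> C"
      have "card D \<noteq> 0" using finD[OF D] D partition_onD3[OF assms(3)] by auto
      have "(\<Sum>(u, v) \<in> D \<times> D - H\<^sup>*. ?f (add_edge H u v)) =
          (\<Sum>(u, v) \<in> D \<times> D - H\<^sup>*. ?w / card D * (1 / card (cls H u) + 1 / card (cls H v)))"
        by (rule sum.cong) (use inside[OF D] in auto)
      also have "\<dots> = ?w / card D * (\<Sum>(u, v) \<in> D \<times> D - H\<^sup>*. 1 / card (cls H u) + 1 / card (cls H v))"
        by (simp add: sum_distrib_left case_prod_unfold)
      also have "\<dots> = ?w * (2 * (real (card {A \<in> ?P. A \<subseteq> D}) - 1))"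
      proof -
        have "?w / card D * s = ?w * (2 * (real (card {A \<in> ?P. A \<subseteq> D}) - 1))"
          if "s = 2 * real (card D) * (real (card {A \<in> ?P. A \<subseteq> D}) - 1)" for s
          using \<open>card D \<noteq> 0\<close> that by simp
        then show ?thesis using sum_arcs_inv_card[OF assms(1) less.prems(1) assms(3) coarse D] .
      qed
      finally show "(\<Sum>(u, v) \<in> D \<times> D - H\<^sup>*. ?f (add_edge H u v)) = \<dots>" .
    qed simp
    also have "\<dots> = ?w * (2 * (real (\<Sum>D\<in>C. card {A \<in> ?P. A \<subseteq> D}) - real (card C)))"
      by (simp add: sum_subtractf flip: sum_distrib_left)
    also have "\<dots> = ?w * (2 * (real (card ?P) - real (card C)))"
      by (rule arg_cong[OF sum_coarse_card_blocks[OF assms(1) less.prems(1) assms(3) coarse]])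
    finally have "(\<Sum>E \<in> bridge_exts V H \<inter> ?X. real (card (E - H))) =
        ?w * (2 * (real (card ?P) - real (card C)))" .
    \<comment> \<open>The number of new arcs is the same for all extensions with components
      \<open>C\<close>, so the left-hand side is a multiple of the wanted count, by a nonzero factor
      because of \<open>lt\<close>.\<close>
    moreover have "(\<Sum>E \<in> bridge_exts V H \<inter> ?X. real (card (E - H))) =
        (\<Sum>E \<in> bridge_exts V H \<inter> ?X. 2 * (real (card ?P) - real (card C)))"
    proof (rule sum.cong)
      fix E assume "E \<in> bridge_exts V H \<inter> ?X"
      then have "card (E - H) + 2 * card C = 2 * card ?P" using bridge_extsD(3)[of E V H] by auto
      then have "real (card (E - H)) + 2 * real (card C) = 2 * real (card ?P)"
        by (metis of_nat_add of_nat_mult of_nat_numeral)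
      then show "real (card (E - H)) = 2 * (real (card ?P) - real (card C))" by simp
    qed simp
    ultimately have "?f H * (2 * (real (card ?P) - real (card C))) =
        ?w * (2 * (real (card ?P) - real (card C)))"
      by simp
    then have "?f H = ?w" using lt by simp
    then show ?thesis by (simp only: Int)
  qed
qed

section \<open>Comparison with forests on the components\<close>

definition coarsenings :: "'a set \<Rightarrow> 'a rel \<Rightarrow> 'a set set set" where
  "coarsenings V H = {C. partition_on V C \<and> (\<forall>A\<in>comps V H. \<exists>D\<in>C. A \<subseteq> D)}"

definition connected_exts :: "'a set \<Rightarrow> 'a rel \<Rightarrow> 'a rel set" where
  "connected_exts V H = {E \<in> bridge_exts V H. comps V E = {V}}"

lemma finite_coarsenings: "finite V \<Longrightarrow> finite (coarsenings V H)"
  using finitely_many_partition_on[of V] by (auto simp: coarsenings_def elim: rev_finite_subset)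

lemma card_bridge_exts_sum:
  assumes "finite V" "H \<in> simple_arcs V"
  shows "real (card (bridge_exts V H)) = (\<Sum>C\<in>coarsenings V H. coarse_weight (comps V H) C)"
proof -
  have "comps V E \<in> coarsenings V H" if E: "E \<in> bridge_exts V H" for E
  proof -
    have "\<exists>D\<in>comps V E. A \<subseteq> D" if "A \<in> comps V H" for A
      using that cls_mono[OF bridge_extsD(2)[OF E]] by (auto simp: comps_def)
    then show ?thesis using partition_on_comps[OF bridge_extsD(1)[OF E]] by (simp add: coarsenings_def)
  qed
  then have "comps V ` bridge_exts V H \<subseteq> coarsenings V H" by blast
  then have "card (bridge_exts V H) = (\<Sum>C\<in>coarsenings V H. card {E \<in> bridge_exts V H. comps V E = C})"
    using sum.group[OF finite_bridge_exts[OF assms(1)] finite_coarsenings[OF assms(1)],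
        of "comps V" H H "\<lambda>_. 1::nat"] by simp
  also have "real \<dots> = (\<Sum>C\<in>coarsenings V H. coarse_weight (comps V H) C)"
    unfolding of_nat_sum
    by (rule sum.cong[OF refl], rule card_bridge_exts_coarse[OF assms]) (auto simp: coarsenings_def)
  finally show ?thesis .
qed

lemma top_coarsening:
  assumes "H \<in> simple_arcs V" "V \<noteq> {}"
  shows "{V} \<in> coarsenings V H"
proof -
  have "A \<subseteq> V" if "A \<in> comps V H" for A
    using that cls_subset[OF simple_arcsD(1)[OF assms(1)]] by (auto simp: comps_def)
  then show ?thesis using assms(2) by (auto simp: coarsenings_def partition_on_def disjoint_def)
qed

text \<open>The classical formula \<open>n^(k - 2)\<close> times the product of the component sizes
  for joining \<open>k\<close> components in a tree-like way; for isolated vertices it is Cayley's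
  formula.\<close>

lemma card_connected_exts:
  assumes "finite V" "H \<in> simple_arcs V" "V \<noteq> {}"
  shows "real (card (connected_exts V H)) =
    (\<Prod>A\<in>comps V H. real (card A)) * (real (card V) ^ card (comps V H) / (real (card V))\<^sup>2)"
proof -
  have "{A \<in> comps V H. A \<subseteq> V} = comps V H"
    using cls_subset[OF simple_arcsD(1)[OF assms(2)]] by (auto simp: comps_def)
  then show ?thesis
    unfolding connected_exts_def
    using card_bridge_exts_coarse[OF assms(1,2), of "{V}"] top_coarsening[OF assms(2,3)]
    by (simp add: coarsenings_def coarse_weight_def)
qed

lemma card_comp_pos:
  assumes "finite V" "H \<in> simple_arcs V" "A \<in> comps V H"
  shows "0 < card A"
  using assms card_cls_pos by (auto simp: comps_def)

lemma comps_prod_pos: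
  assumes "finite V" "H \<in> simple_arcs V"
  shows "0 < (\<Prod>A\<in>comps V H. real (card A))"
  using card_comp_pos[OF assms] by (intro prod_pos) auto

lemma card_connected_exts_pos:
  assumes "finite V" "H \<in> simple_arcs V" "V \<noteq> {}"
  shows "0 < card (connected_exts V H)"
proof -
  have "0 < real (card (connected_exts V H))"
    using card_connected_exts[OF assms] comps_prod_pos[OF assms(1,2)] assms(1,3)
    by (simp add: card_gt_0_iff)
  then show ?thesis by simp
qed

text \<open>Gibbs' inequality for the distributions \<open>b D / N\<close> and
  \<open>k D / K\<close>, in exponential form. It follows from \<open>x \<le> exp (x - 1)\<close>
  applied to the quotients \<open>x\<close> of the two: raised to the powers \<open>k D\<close>, the
  exponents sum to \<open>N * (K / N) - K = 0\<close>.\<close>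

lemma gibbs_prod:
  fixes b :: "'b \<Rightarrow> real" and k :: "'b \<Rightarrow> nat"
  assumes "finite C" "C \<noteq> {}" "\<And>D. D \<in> C \<Longrightarrow> 0 < b D" "\<And>D. D \<in> C \<Longrightarrow> 0 < k D"
  shows "(\<Prod>D\<in>C. b D ^ k D) / sum b C ^ sum k C \<le>
    (\<Prod>D\<in>C. real (k D) ^ k D) / real (sum k C) ^ sum k C"
proof -
  define N K where "N = sum b C" and "K = sum k C"
  have N: "0 < N" unfolding N_def using assms by (intro sum_pos) auto
  have K: "0 < K" unfolding K_def using assms by (intro sum_pos) auto
  let ?x = "\<lambda>D. (b D / N) / (k D / K)"
  have x0: "0 \<le> ?x D" if "D \<in> C" for D
    using assms(3)[OF that] N by simp
  have "(\<Prod>D\<in>C. ?x D ^ k D) \<le> (\<Prod>D\<in>C. exp (real (k D) * (?x D - 1)))"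
  proof (rule prod_mono, rule conjI)
    fix D assume D: "D \<in> C"
    show "0 \<le> ?x D ^ k D" using x0[OF D] by simp
    have "?x D \<le> exp (?x D - 1)" using exp_ge_add_one_self[of "?x D - 1"] by simp
    then have "?x D ^ k D \<le> exp (?x D - 1) ^ k D" using x0[OF D] by (rule power_mono)
    then show "?x D ^ k D \<le> exp (real (k D) * (?x D - 1))" by (simp add: exp_of_nat_mult)
  qed
  also have "\<dots> = exp (\<Sum>D\<in>C. real (k D) * (?x D - 1))" using assms(1) by (simp add: exp_sum)
  also have "(\<Sum>D\<in>C. real (k D) * (?x D - 1)) = (\<Sum>D\<in>C. b D * (K / N) - real (k D))"
  proof (rule sum.cong)
    fix D assume "D \<in> C"
    then have "real (k D) \<noteq> 0" using assms(4)[of D] by simp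
    then show "real (k D) * (?x D - 1) = b D * (K / N) - real (k D)"
      by (simp add: field_simps)
  qed simp
  also have "\<dots> = N * (K / N) - K" by (simp only: N_def K_def sum_subtractf sum_distrib_right of_nat_sum)
  also have "\<dots> = 0" using N by simp
  finally have le: "(\<Prod>D\<in>C. ?x D ^ k D) \<le> 1" by simp
  have pw: "(\<Prod>D\<in>C. c ^ k D) = c ^ K" for c :: real by (simp add: power_sum K_def)
  have "(\<Prod>D\<in>C. ?x D ^ k D) =
      (\<Prod>D\<in>C. b D ^ k D) / N ^ K / ((\<Prod>D\<in>C. real (k D) ^ k D) / real K ^ K)"
    by (simp add: power_divide power_mult_distrib prod.distrib prod_dividef pw)
  moreover have "0 < (\<Prod>D\<in>C. real (k D) ^ k D) / real K ^ K"
    using assms(4) K by (intro divide_pos_pos prod_pos zero_less_power) auto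
  ultimately show ?thesis using le unfolding N_def[symmetric] K_def[symmetric] by (simp only: divide_le_eq_1_pos)
qed

text \<open>In this form sum over product is visibly decreasing in every \<open>b D\<close>.\<close>

lemma sum_div_prod:
  fixes b :: "'b \<Rightarrow> real"
  assumes "finite C" "\<And>D. D \<in> C \<Longrightarrow> b D \<noteq> 0"
  shows "sum b C / prod b C = (\<Sum>D\<in>C. 1 / prod b (C - {D}))"
proof -
  have "b D / prod b C = 1 / prod b (C - {D})" if "D \<in> C" for D
    using assms that by (simp add: prod.remove[OF assms(1) that])
  then show ?thesis by (simp add: sum_divide_distrib)
qed

text \<open>The quotient splits into a part with exponents \<open>k D\<close>, where
  \<open>gibbs_prod\<close> replaces the sizes \<open>b D\<close> by \<open>k D\<close>, and the
  square of sum over product, which is decreasing in the sizes, so that \<open>k D \<le> b D\<close>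
  applies.\<close>

lemma partition_weight_le:
  fixes b k :: "'b \<Rightarrow> nat"
  assumes "finite C" "C \<noteq> {}" "\<And>D. D \<in> C \<Longrightarrow> 0 < k D" "\<And>D. D \<in> C \<Longrightarrow> k D \<le> b D"
  shows "(\<Prod>D\<in>C. real (b D) ^ k D / (real (b D))\<^sup>2) / (real (sum b C) ^ sum k C / (real (sum b C))\<^sup>2)
    \<le> (\<Prod>D\<in>C. real (k D) ^ k D / (real (k D))\<^sup>2) / (real (sum k C) ^ sum k C / (real (sum k C))\<^sup>2)"
proof -
  have b: "0 < b D" if "D \<in> C" for D using assms(3,4)[OF that] by linarith
  have split: "(\<Prod>D\<in>C. real (c D) ^ k D / (real (c D))\<^sup>2) / (real (sum c C) ^ sum k C / (real (sum c C))\<^sup>2)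
      = ((\<Prod>D\<in>C. real (c D) ^ k D) / sum (\<lambda>D. real (c D)) C ^ sum k C) *
        (sum (\<lambda>D. real (c D)) C / (\<Prod>D\<in>C. real (c D)))\<^sup>2" for c
    by (simp add: prod_dividef power_divide prod_power_distrib)
  have "sum (\<lambda>D. real (b D)) C / (\<Prod>D\<in>C. real (b D)) = (\<Sum>D\<in>C. 1 / (\<Prod>D\<in>C - {D}. real (b D)))"
    using sum_div_prod[OF assms(1), of "\<lambda>D. real (b D)"] b by force
  also have "\<dots> \<le> (\<Sum>D\<in>C. 1 / (\<Prod>D\<in>C - {D}. real (k D)))"
  proof (rule sum_mono)
    fix D assume "D \<in> C"
    show "1 / (\<Prod>D\<in>C - {D}. real (b D)) \<le> 1 / (\<Prod>D\<in>C - {D}. real (k D))"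
      using assms(3,4) by (intro divide_left_mono prod_mono mult_pos_pos prod_pos) (auto simp: b)
  qed
  also have "\<dots> = sum (\<lambda>D. real (k D)) C / (\<Prod>D\<in>C. real (k D))"
    using sum_div_prod[OF assms(1), of "\<lambda>D. real (k D)"] assms(3) by force
  finally have 2: "(sum (\<lambda>D. real (b D)) C / (\<Prod>D\<in>C. real (b D)))\<^sup>2 \<le>
      (sum (\<lambda>D. real (k D)) C / (\<Prod>D\<in>C. real (k D)))\<^sup>2"
    by (intro power_mono divide_nonneg_nonneg sum_nonneg prod_nonneg) auto
  have 1: "(\<Prod>D\<in>C. real (b D) ^ k D) / sum (\<lambda>D. real (b D)) C ^ sum k C \<le>
      (\<Prod>D\<in>C. real (k D) ^ k D) / sum (\<lambda>D. real (k D)) C ^ sum k C"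
    using gibbs_prod[OF assms(1,2), of "\<lambda>D. real (b D)" k] b assms(3) by simp
  show ?thesis
    unfolding split[of b] split[of k]
    by (rule mult_mono[OF 1 2]) (auto intro!: divide_nonneg_nonneg prod_nonneg sum_nonneg zero_le_power)
qed

lemma empty_simple: "{} \<in> simple_arcs V"
  by (simp add: simple_arcs_def sym_def irrefl_def)

lemma comps_empty: "comps V {} = (\<lambda>v. {v}) ` V"
  by (auto simp: comps_def cls_def)

lemma card_comps_empty: "card (comps V {}) = card V"
  unfolding comps_empty by (simp add: card_image)

text \<open>Each component of \<open>H\<close> is shrunk to one point of \<open>W\<close>. A
  coarsening of the components then becomes a partition of \<open>W\<close>, and the two ratios are
  compared term by term.\<close>

lemma bridge_exts_ratio_le:
  fixes V :: "'a set" and W :: "'b set"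
  assumes "finite V" "H \<in> simple_arcs V" "V \<noteq> {}" "finite W" "card W = card (comps V H)"
  shows "real (card (bridge_exts V H)) / card (connected_exts V H) \<le>
    real (card (bridge_exts W {})) / card (connected_exts W ({} :: 'b rel))"
proof -
  let ?P = "comps V H"
  let ?k = "\<lambda>D. card {A \<in> ?P. A \<subseteq> D}"
  have finP: "finite ?P" using finite_comps[OF assms(1)] .
  have Kpos: "0 < card ?P" using finP assms(3) by (auto simp: card_gt_0_iff comps_def)
  have Wne: "W \<noteq> {}" using assms(5) Kpos by auto
  obtain \<phi> where \<phi>: "bij_betw \<phi> ?P W"
    using finite_same_card_bij[OF finP assms(4)] assms(5) by auto
  have inj\<phi>: "inj_on \<phi> ?P" using \<phi> by (rule bij_betw_imp_inj_on)
  \<comment> \<open>\<open>h\<close> sends a block to the points standing for the components inside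
    it; \<open>g\<close> recovers the block as the union of those components.\<close>
  define h where "h D = \<phi> ` {A \<in> ?P. A \<subseteq> D}" for D
  define g where "g D' = \<Union> (the_inv_into ?P \<phi> ` D')" for D'
  let ?q = "\<lambda>C. coarse_weight ?P C / card (connected_exts V H)"
  let ?r = "\<lambda>C. coarse_weight (comps W {}) C / card (connected_exts W ({} :: 'b rel))"
  have gh: "g (h D) = D" if C: "C \<in> coarsenings V H" "D \<in> C" for C D
  proof -
    have *: "partition_on V C" "\<And>A. A \<in> ?P \<Longrightarrow> \<exists>D\<in>C. A \<subseteq> D" using C by (auto simp: coarsenings_def)
    have "the_inv_into ?P \<phi> ` h D = {A \<in> ?P. A \<subseteq> D}"
      unfolding h_def image_image by (auto simp: the_inv_into_f_f[OF inj\<phi>] image_iff)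
    then have "g (h D) = \<Union> {A \<in> ?P. A \<subseteq> D}" by (simp add: g_def)
    moreover have "D \<subseteq> \<Union> {A \<in> ?P. A \<subseteq> D}"
    proof
      fix u assume u: "u \<in> D"
      have "u \<in> V" using u *(1) C(2) partition_onD1 by blast
      then have "cls H u \<in> {A \<in> ?P. A \<subseteq> D}"
        using comps_closed[OF assms(2) * C(2) u] by (simp add: comps_def)
      then show "u \<in> \<Union> {A \<in> ?P. A \<subseteq> D}" using cls_refl[of u H] by blast
    qed
    ultimately show ?thesis by blast
  qed
  have cardh: "card (h D) = ?k D" for D
    unfolding h_def by (rule card_image) (rule inj_on_subset[OF inj\<phi>], blast)
  have into: "h ` C \<in> coarsenings W {}" if C: "C \<in> coarsenings V H" for C
  proof -
    have *: "partition_on V C" "\<And>A. A \<in> ?P \<Longrightarrow> \<exists>D\<in>C. A \<subseteq> D" using C by (auto simp: coarsenings_def)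
    have "partition_on W (h ` C)"
    proof (rule partition_onI)
      have "\<Union> (h ` C) = \<phi> ` (\<Union>D\<in>C. {A \<in> ?P. A \<subseteq> D})" by (auto simp: h_def)
      also have "(\<Union>D\<in>C. {A \<in> ?P. A \<subseteq> D}) = ?P" using *(2) by blast
      finally show "\<Union> (h ` C) = W" using \<phi> by (simp add: bij_betw_def)
      show "{} \<notin> h ` C"
      proof
        assume "{} \<in> h ` C"
        then obtain D where "D \<in> C" "h D = {}" by auto
        then show False using coarse_card_block_pos[OF assms(1,2) *, of D] cardh[of D] by simp
      qed
      show "disjnt p q" if pq: "p \<in> h ` C" "q \<in> h ` C" "p \<noteq> q" for p q
      proof -
        obtain D D' where D: "D \<in> C" "D' \<in> C" "p = h D" "q = h D'" using pq by blast
        then have "D \<inter> D' = {}" using disjointD[OF partition_onD2[OF *(1)] D(1,2)] pq(3) by auto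
        then have "{A \<in> ?P. A \<subseteq> D} \<inter> {A \<in> ?P. A \<subseteq> D'} = {}"
          using comps_nonempty[of _ V H] by blast
        then show ?thesis
          unfolding D h_def disjnt_def
          using inj_on_image_Int[OF inj\<phi>, of "{A \<in> ?P. A \<subseteq> D}" "{A \<in> ?P. A \<subseteq> D'}"] by auto
      qed
    qed
    then show ?thesis using partition_onD1 by (fastforce simp: coarsenings_def comps_empty)
  qed
  have le: "?q C \<le> ?r (h ` C)" if C: "C \<in> coarsenings V H" for C
  proof -
    have *: "partition_on V C" "\<And>A. A \<in> ?P \<Longrightarrow> \<exists>D\<in>C. A \<subseteq> D" using C by (auto simp: coarsenings_def)
    have finC: "finite C" using finite_elements[OF assms(1) *(1)] .
    have injh: "inj_on h C" using gh[OF C] by (metis inj_onI)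
    have finD: "finite D" if "D \<in> C" for D
      using that partition_onD1[OF *(1)] assms(1) by (auto intro: finite_subset)
    have sumb: "sum card C = card V"
      using card_Union_disjoint[of C] partition_onD1[OF *(1)] partition_onD2[OF *(1)] finD
      by (simp add: disjoint_def pairwise_def disjnt_def)
    have Cne: "C \<noteq> {}" using partition_onD1[OF *(1)] assms(3) by auto
    have sumk: "sum ?k C = card ?P" using sum_coarse_card_blocks[OF assms(1,2) *] .
    have kb: "?k D \<le> card D" if D: "D \<in> C" for D
    proof -
      have "real (?k D) = (\<Sum>u\<in>D. 1 / card (cls H u))"
        using coarse_card_blocks[OF assms(1,2) * D] .
      also have "\<dots> \<le> (\<Sum>u\<in>D. 1)"
      proof (rule sum_mono)
        fix u assume "u \<in> D"
        then have "0 < card (cls H u)"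
          using card_cls_pos[OF assms(1,2), of u] partition_onD1[OF *(1)] D by blast
        then show "1 / real (card (cls H u)) \<le> 1" by simp
      qed
      finally show ?thesis by simp
    qed
    \<comment> \<open>The product of the component sizes of \<open>H\<close> occurs in both counts
      and cancels, so only the block sizes and the numbers of components per block remain.\<close>
    have "?q C = (\<Prod>D\<in>C. real (card D) ^ ?k D / (real (card D))\<^sup>2) /
        (real (card V) ^ card ?P / (real (card V))\<^sup>2)"
      unfolding coarse_weight_def card_connected_exts[OF assms(1-3)]
      using comps_prod_pos[OF assms(1,2)] by (simp del: prod_eq_1_iff)
    also have "\<dots> \<le> (\<Prod>D\<in>C. real (?k D) ^ ?k D / (real (?k D))\<^sup>2) /
        (real (card ?P) ^ card ?P / (real (card ?P))\<^sup>2)"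
      unfolding sumb[symmetric] sumk[symmetric]
    proof (rule partition_weight_le[OF finC Cne])
      show "0 < ?k D" if "D \<in> C" for D using coarse_card_block_pos[OF assms(1,2) * that] .
      show "?k D \<le> card D" if "D \<in> C" for D using kb[OF that] .
    qed
    also have "(\<Prod>D\<in>C. real (?k D) ^ ?k D / (real (?k D))\<^sup>2) =
        (\<Prod>D'\<in>h ` C. real (card D') ^ card D' / (real (card D'))\<^sup>2)"
      by (simp add: prod.reindex[OF injh] cardh)
    also have "\<dots> = (\<Prod>D'\<in>h ` C. real (card D') ^ card {A \<in> comps W {}. A \<subseteq> D'} / (real (card D'))\<^sup>2)"
    proof (rule prod.cong)
      fix D' assume "D' \<in> h ` C"
      then have "D' \<subseteq> W" using into[OF C] partition_onD1 by (fastforce simp: coarsenings_def)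
      then have "{A \<in> comps W {}. A \<subseteq> D'} = (\<lambda>v. {v}) ` D'" by (auto simp: comps_empty)
      then show "real (card D') ^ card D' / (real (card D'))\<^sup>2 =
          real (card D') ^ card {A \<in> comps W {}. A \<subseteq> D'} / (real (card D'))\<^sup>2"
        by (simp add: card_image)
    qed simp
    also have "\<dots> / (real (card ?P) ^ card ?P / (real (card ?P))\<^sup>2) = ?r (h ` C)"
      unfolding coarse_weight_def card_connected_exts[OF assms(4) empty_simple Wne] card_comps_empty
      using comps_prod_pos[OF assms(4) empty_simple] assms(5) by (simp del: prod_eq_1_iff)
    finally show ?thesis .
  qed
  \<comment> \<open>Distinct coarsenings give distinct terms on the right, where all terms are
    nonnegative.\<close>
  have inj: "inj_on ((`) h) (coarsenings V H)"
  proof (rule inj_on_inverseI[where g = "(`) g"])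
    fix C assume C: "C \<in> coarsenings V H"
    show "g ` h ` C = C" using gh[OF C] by (auto simp: image_iff)
  qed
  have "real (card (bridge_exts V H)) / card (connected_exts V H) = (\<Sum>C\<in>coarsenings V H. ?q C)"
    using card_bridge_exts_sum[OF assms(1,2)] by (simp add: sum_divide_distrib)
  also have "\<dots> \<le> (\<Sum>C\<in>coarsenings V H. ?r (h ` C))" using le by (rule sum_mono)
  also have "\<dots> = (\<Sum>C\<in>(`) h ` coarsenings V H. ?r C)" by (simp add: sum.reindex[OF inj])
  also have "\<dots> \<le> (\<Sum>C\<in>coarsenings W {}. ?r C)"
  proof (rule sum_mono2)
    show "finite (coarsenings W ({} :: 'b rel))" using finite_coarsenings[OF assms(4)] .
    show "(`) h ` coarsenings V H \<subseteq> coarsenings W {}" using into by blast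
    show "0 \<le> ?r C" for C by (simp add: coarse_weight_def prod_nonneg)
  qed
  also have "\<dots> = real (card (bridge_exts W {})) / card (connected_exts W ({} :: 'b rel))"
    using card_bridge_exts_sum[OF assms(4) empty_simple] by (simp add: sum_divide_distrib)
  finally show ?thesis .
qed

section \<open>Counting extensions by number of components\<close>

definition layer :: "'a set \<Rightarrow> 'a rel \<Rightarrow> nat \<Rightarrow> 'a rel set" where
  "layer V H m = {E \<in> bridge_exts V H. card (comps V E) = m}"

lemma finite_layer: "finite V \<Longrightarrow> finite (layer V H m)"
  using finite_bridge_exts[of V H] by (simp add: layer_def)

lemma comps_eq_top_iff:
  assumes "E \<in> simple_arcs V" "V \<noteq> {}"
  shows "comps V E = {V} \<longleftrightarrow> card (comps V E) = 1"
proof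
  assume "card (comps V E) = 1"
  then obtain A where A: "comps V E = {A}" using card_1_singletonE by blast
  then have "A = V" using Union_comps[OF simple_arcsD(1)[OF assms(1)]] by simp
  then show "comps V E = {V}" using A by simp
qed simp

lemma layer_1:
  assumes "V \<noteq> {}" shows "layer V H 1 = connected_exts V H"
  using comps_eq_top_iff[OF bridge_extsD(1) assms]
  unfolding layer_def connected_exts_def by blast

lemma add_edge_in_bridge_exts:
  assumes "finite V" "H \<in> simple_arcs V" "E \<in> bridge_exts V H" "u \<in> V" "v \<in> V" "(u, v) \<notin> E\<^sup>*"
  shows "add_edge E u v \<in> bridge_exts V H" "(u, v) \<in> add_edge E u v - H"
proof -
  note E = bridge_extsD[OF assms(3)]
  note sE = simple_arcsD[OF E(1)]
  have uvE: "(u, v) \<notin> E" "(v, u) \<notin> E" using assms(6) sE(2) by (auto dest: symD)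
  have ne: "u \<noteq> v" using assms(6) by auto
  have c: "Suc (card (comps V (add_edge E u v))) = card (comps V E)"
    using card_comps_add_edge[OF sE(2) assms(4-6,1)] .
  have s: "add_edge E u v \<in> simple_arcs V" using add_edge_simple[OF E(1) assms(4,5) ne] .
  have uvH: "(u, v) \<notin> H" "(v, u) \<notin> H" using uvE E(2) by auto
  have "card (add_edge E u v - H) = card (add_edge E u v - add_edge H u v) + 2"
    using card_Diff_add_edge[OF finite_arcs[OF assms(1) s] _ _ uvH ne] by (simp add: add_edge_def)
  moreover have "add_edge E u v - add_edge H u v = E - H" using uvE by (auto simp: add_edge_def)
  ultimately have "card (add_edge E u v - H) = card (E - H) + 2" by simp
  then show "add_edge E u v \<in> bridge_exts V H"
    using s c E(2,3) by (auto simp: bridge_exts_def add_edge_def)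
  show "(u, v) \<in> add_edge E u v - H" using uvH by (simp add: add_edge_def)
qed

text \<open>The extremal case is \<open>m\<close> isolated vertices and one component of size
  \<open>n - m\<close>, with \<open>n^2 - m - (n - m)^2\<close> separated ordered pairs. No
  component is larger than \<open>n - m\<close>, since the other \<open>m\<close> are nonempty, and
  on sizes \<open>a\<close> from \<open>1\<close> to \<open>n - m\<close> the square lies below its
  chord: \<open>a^2 \<le> 1 + (a - 1) (n - m + 1)\<close>.\<close>

lemma card_non_connected_pairs_ge:
  assumes "finite V" "E \<in> simple_arcs V" "card (comps V E) = Suc m"
  shows "real m * (2 * real (card V) - real m - 1) \<le> real (card (V \<times> V - E\<^sup>*))"
proof -
  let ?P = "comps V E" and ?n = "real (card V)"
  have closed: "\<And>u. u \<in> V \<Longrightarrow> cls E u \<subseteq> V" using cls_subset[OF simple_arcsD(1)[OF assms(2)]] .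
  then have allP: "{A \<in> ?P. A \<subseteq> V} = ?P" by (auto simp: comps_def)
  have finP: "finite ?P" using finite_comps[OF assms(1)] .
  have pos: "1 \<le> card A" if "A \<in> ?P" for A using card_comp_pos[OF assms(1,2) that] by simp
  have sumP: "(\<Sum>A\<in>?P. real (card A)) = ?n"
  proof -
    have "(\<Sum>A\<in>?P. real (card A)) = (\<Sum>u\<in>V. real (card (cls E u)) / card (cls E u))"
      using sum_over_comps[OF assms(1,2) subset_refl closed, of "\<lambda>A. real (card A)"] allP by simp
    also have "\<dots> = (\<Sum>u\<in>V. 1)"
    proof (rule sum.cong)
      fix u assume "u \<in> V"
      then have "card (cls E u) \<noteq> 0" using card_cls_pos[OF assms(1,2), of u] by simp
      then show "real (card (cls E u)) / card (cls E u) = 1" by simp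
    qed simp
    finally show ?thesis by simp
  qed
  have sumsq: "(\<Sum>u\<in>V. real (card (cls E u))) = (\<Sum>A\<in>?P. (real (card A))\<^sup>2)"
  proof -
    have "(\<Sum>A\<in>?P. (real (card A))\<^sup>2) = (\<Sum>u\<in>V. (real (card (cls E u)))\<^sup>2 / card (cls E u))"
      using sum_over_comps[OF assms(1,2) subset_refl closed, of "\<lambda>A. (real (card A))\<^sup>2"] allP by simp
    also have "\<dots> = (\<Sum>u\<in>V. real (card (cls E u)))"
      by (rule sum.cong) (auto simp: power2_eq_square)
    finally show ?thesis ..
  qed
  have le: "real (card A) \<le> ?n - m" if A: "A \<in> ?P" for A
  proof -
    have "real m = (\<Sum>B\<in>?P - {A}. 1)" using A assms(3) finP by simp
    also have "\<dots> \<le> (\<Sum>B\<in>?P - {A}. real (card B))" using pos by (intro sum_mono) force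
    also have "\<dots> = ?n - card A" using sum.remove[OF finP A, of "\<lambda>A. real (card A)"] sumP by simp
    finally show ?thesis by simp
  qed
  have "(\<Sum>A\<in>?P. (real (card A))\<^sup>2) \<le> (\<Sum>A\<in>?P. 1 + (real (card A) - 1) * (?n - m + 1))"
  proof (rule sum_mono)
    fix A assume A: "A \<in> ?P"
    have "(real (card A) - 1) * (real (card A) + 1) \<le> (real (card A) - 1) * (?n - m + 1)"
      using le[OF A] pos[OF A] by (intro mult_left_mono) auto
    then show "(real (card A))\<^sup>2 \<le> 1 + (real (card A) - 1) * (?n - m + 1)"
      by (simp add: power2_eq_square algebra_simps)
  qed
  also have "\<dots> = real (Suc m) + (?n - real (Suc m)) * (?n - m + 1)"
    by (simp only: sum.distrib sum_subtractf sum_distrib_right[symmetric] sumP sum_constant assms(3) mult_1_right)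
  finally have "(\<Sum>u\<in>V. real (card (cls E u))) \<le> m + (?n - m)\<^sup>2"
    unfolding sumsq by (simp add: power2_eq_square algebra_simps)
  moreover have "real (card (V \<times> V - E\<^sup>*)) = (\<Sum>u\<in>V. ?n - real (card (cls E u)))"
    using sum_pairs_fst[OF assms(1) closed, of "\<lambda>_. 1"] by (simp add: case_prod_unfold)
  ultimately show ?thesis by (simp add: sum_subtractf power2_eq_square algebra_simps)
qed

text \<open>Adding an edge between two components, and remembering its arc, maps pairs (member of
  layer \<open>m + 1\<close>, separated pair) injectively to pairs (member of layer
  \<open>m\<close>, new arc). A member of layer \<open>m\<close> has exactly
  \<open>2 (k - m)\<close> new arcs.\<close>

lemma layer_Suc_mult_le:
  assumes "finite V" "H \<in> simple_arcs V"
  shows "real (card (layer V H (Suc m))) * (real m * (2 * real (card V) - real m - 1)) \<le>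
    2 * (real (card (comps V H)) - real m) * real (card (layer V H m))"
proof -
  let ?A = "SIGMA E:layer V H (Suc m). V \<times> V - E\<^sup>*"
  let ?B = "SIGMA E:layer V H m. E - H"
  let ?f = "\<lambda>(E, (u, v)). (add_edge E u v, (u, v))"
  have finA: "\<forall>E\<in>layer V H (Suc m). finite (V \<times> V - E\<^sup>*)" using assms(1) by simp
  have finB: "\<forall>E\<in>layer V H m. finite (E - H)"
    using finite_arcs[OF assms(1)] by (auto simp: layer_def bridge_exts_def)
  have inj: "inj_on ?f ?A"
  proof (rule inj_onI)
    fix x y assume xy: "x \<in> ?A" "y \<in> ?A" "?f x = ?f y"
    obtain E u v where x: "x = (E, (u, v))" by (metis prod.exhaust)
    obtain E' where y: "y = (E', (u, v))" using xy(3) x by (cases y) auto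
    have E: "E \<in> layer V H (Suc m)" "E' \<in> layer V H (Suc m)"
      "(u, v) \<notin> E\<^sup>*" "(u, v) \<notin> E'\<^sup>*" "add_edge E u v = add_edge E' u v"
      using xy unfolding x y by auto
    have sym: "sym E" "sym E'" using E(1,2) by (auto simp: layer_def bridge_exts_def simple_arcs_def)
    have "(u, v) \<notin> E" "(v, u) \<notin> E" "(u, v) \<notin> E'" "(v, u) \<notin> E'"
      using E(3,4) sym by (auto dest: symD)
    then have "E = add_edge E u v - {(u, v), (v, u)}" "E' = add_edge E' u v - {(u, v), (v, u)}"
      by (auto simp: add_edge_def)
    then show "x = y" using E(5) x y by simp
  qed
  have sub: "?f ` ?A \<subseteq> ?B"
  proof (rule image_subsetI)
    fix x assume x: "x \<in> ?A"
    obtain E u v where xE: "x = (E, (u, v))" by (metis prod.exhaust)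
    have E: "E \<in> layer V H (Suc m)" "(u, v) \<notin> E\<^sup>*" "u \<in> V" "v \<in> V"
      using x unfolding xE by auto
    have b: "E \<in> bridge_exts V H" "card (comps V E) = Suc m" using E(1) by (auto simp: layer_def)
    note X = add_edge_in_bridge_exts[OF assms b(1) E(3,4,2)]
    have "card (comps V (add_edge E u v)) = m"
      using card_comps_add_edge[OF simple_arcsD(2)[OF bridge_extsD(1)[OF b(1)]] E(3,4,2) assms(1)] b(2)
      by simp
    then show "?f x \<in> ?B" using X unfolding xE by (simp add: layer_def)
  qed
  have "card ?A \<le> card ?B"
    using finB by (intro card_inj_on_le[OF inj sub] finite_SigmaI finite_layer[OF assms(1)]) simp
  moreover have "card ?A = (\<Sum>E\<in>layer V H (Suc m). card (V \<times> V - E\<^sup>*))"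
    using finite_layer[OF assms(1)] finA by (simp add: card_SigmaI)
  moreover have "card ?B = (\<Sum>E\<in>layer V H m. card (E - H))"
    using finite_layer[OF assms(1)] finB by (simp add: card_SigmaI)
  ultimately have "(\<Sum>E\<in>layer V H (Suc m). card (V \<times> V - E\<^sup>*)) \<le> (\<Sum>E\<in>layer V H m. card (E - H))"
    by simp
  then have le: "(\<Sum>E\<in>layer V H (Suc m). real (card (V \<times> V - E\<^sup>*))) \<le>
      (\<Sum>E\<in>layer V H m. real (card (E - H)))"
    by (simp only: of_nat_sum[symmetric] of_nat_le_iff)
  have "real (card (layer V H (Suc m))) * (real m * (2 * real (card V) - real m - 1)) =
      (\<Sum>E\<in>layer V H (Suc m). real m * (2 * real (card V) - real m - 1))"
    by simp
  also have "\<dots> \<le> (\<Sum>E\<in>layer V H (Suc m). real (card (V \<times> V - E\<^sup>*)))"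
    by (rule sum_mono, rule card_non_connected_pairs_ge[OF assms(1)]) (auto simp: layer_def bridge_exts_def)
  also note le
  also have "(\<Sum>E\<in>layer V H m. real (card (E - H))) =
      (\<Sum>E\<in>layer V H m. 2 * (real (card (comps V H)) - real m))"
  proof (rule sum.cong)
    fix E assume "E \<in> layer V H m"
    then have "card (E - H) + 2 * m = 2 * card (comps V H)" by (auto simp: layer_def bridge_exts_def)
    then have "real (card (E - H)) + 2 * real m = 2 * real (card (comps V H))"
      by (metis of_nat_add of_nat_mult of_nat_numeral)
    then show "real (card (E - H)) = 2 * (real (card (comps V H)) - real m)" by simp
  qed simp
  finally show ?thesis by (simp add: mult.commute)
qed

lemma card_comps_le_card: "finite V \<Longrightarrow> card (comps V H) \<le> card V"
  unfolding comps_def by (rule card_image_le)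

lemma card_comps_bridge_exts_le: "E \<in> bridge_exts V H \<Longrightarrow> card (comps V E) \<le> card (comps V H)"
  using bridge_extsD(3)[of E V H] by linarith

lemma layer_Suc_le:
  assumes "finite V" "H \<in> simple_arcs V" "0 < m"
  shows "real (card (layer V H (Suc m))) \<le>
    real (card (comps V H)) / real (card V) / real m * real (card (layer V H m))"
proof (cases "Suc m \<le> card (comps V H)")
  case False
  then have "layer V H (Suc m) = {}" using card_comps_bridge_exts_le by (fastforce simp: layer_def)
  then show ?thesis by simp
next
  case True
  let ?k = "real (card (comps V H))" and ?n = "real (card V)" and ?m = "real m"
  let ?a = "real (card (layer V H (Suc m)))" and ?b = "real (card (layer V H m))"
  have kn: "?k \<le> ?n" using card_comps_le_card[OF assms(1)] by simp
  have mk: "?m + 1 \<le> ?k" using True by linarith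
  have m: "1 \<le> ?m" using assms(3) by simp
  have pos: "0 < 2 * ?n - ?m - 1" using kn mk m by linarith
  \<comment> \<open>Combines \<open>k \<le> n\<close> with \<open>m + 1 \<le> 2 m\<close>; the
    latter is where \<open>m\<close> must be positive.\<close>
  have "?k * (?m + 1) \<le> ?n * (2 * ?m)" using kn mk m by (intro mult_mono) auto
  then have key: "2 * (?k - ?m) * ?n \<le> ?k * (2 * ?n - ?m - 1)" by (simp add: algebra_simps)
  have "?a * (?m * (2 * ?n - ?m - 1)) * ?n \<le> 2 * (?k - ?m) * ?b * ?n"
    using layer_Suc_mult_le[OF assms(1,2)] by (rule mult_right_mono) simp
  also have "\<dots> = 2 * (?k - ?m) * ?n * ?b" by simp
  also have "\<dots> \<le> ?k * (2 * ?n - ?m - 1) * ?b" using key by (rule mult_right_mono) simp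
  finally have "(2 * ?n - ?m - 1) * (?a * (?m * ?n)) \<le> (2 * ?n - ?m - 1) * (?k * ?b)"
    by (simp add: mult_ac)
  then have "?a * (?m * ?n) \<le> ?k * ?b" using pos by (simp only: mult_le_cancel_left_pos)
  then show ?thesis using m kn mk by (simp add: field_simps)
qed

lemma layer_le:
  assumes "finite V" "H \<in> simple_arcs V"
  shows "real (card (layer V H (Suc m))) \<le>
    (real (card (comps V H)) / real (card V)) ^ m / fact m * real (card (layer V H 1))"
proof (induction m)
  case (Suc m)
  let ?x = "real (card (comps V H)) / real (card V)"
  have "real (card (layer V H (Suc (Suc m)))) \<le> ?x / real (Suc m) * real (card (layer V H (Suc m)))"
    by (rule layer_Suc_le[OF assms]) simp
  also have "\<dots> \<le> ?x / real (Suc m) * (?x ^ m / fact m * real (card (layer V H 1)))"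
    by (rule mult_left_mono[OF Suc]) simp
  also have "\<dots> = ?x ^ Suc m / fact (Suc m) * real (card (layer V H 1))" by simp
  finally show ?case .
qed simp

text \<open>By \<open>layer_le\<close>, the counts by number of components, relative to the
  connected ones, are bounded by the terms of the exponential series at
  \<open>k / n\<close>.\<close>

lemma bridge_exts_exp_bound:
  assumes "finite V" "H \<in> simple_arcs V" "V \<noteq> {}"
  shows "real (card (bridge_exts V H)) \<le>
    exp (real (card (comps V H)) / real (card V)) * real (card (connected_exts V H))"
proof -
  let ?x = "real (card (comps V H)) / real (card V)" and ?k = "card (comps V H)"
  have "card (comps V E) \<in> Suc ` {..<?k}" if E: "E \<in> bridge_exts V H" for E
  proof -
    have "0 < card (comps V E)"
      using assms(3) finite_comps[OF assms(1)] by (auto simp: comps_def card_gt_0_iff)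
    then obtain m where "card (comps V E) = Suc m" using gr0_implies_Suc by blast
    then show ?thesis using card_comps_bridge_exts_le[OF E] by auto
  qed
  then have img: "(\<lambda>E. card (comps V E)) ` bridge_exts V H \<subseteq> Suc ` {..<?k}" by blast
  have "card (bridge_exts V H) = (\<Sum>m\<in>Suc ` {..<?k}. card (layer V H m))"
    using sum.group[OF finite_bridge_exts[OF assms(1)] _ img, of "\<lambda>_. 1::nat"] by (simp add: layer_def)
  also have "\<dots> = (\<Sum>m<?k. card (layer V H (Suc m)))" by (simp add: sum.reindex)
  finally have "real (card (bridge_exts V H)) = (\<Sum>m<?k. real (card (layer V H (Suc m))))" by simp
  also have "\<dots> \<le> (\<Sum>m<?k. ?x ^ m / fact m * real (card (layer V H 1)))"
    by (rule sum_mono) (rule layer_le[OF assms(1,2)])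
  also have "\<dots> = (\<Sum>m<?k. ?x ^ m / fact m) * real (card (layer V H 1))"
    by (simp add: sum_distrib_right)
  also have "\<dots> \<le> exp ?x * real (card (layer V H 1))"
  proof (rule mult_right_mono)
    have s: "(\<lambda>m. ?x ^ m / fact m) sums exp ?x"
      using exp_converges[of ?x] by (simp add: divide_inverse mult.commute)
    have "(\<Sum>m<?k. ?x ^ m / fact m) \<le> (\<Sum>m. ?x ^ m / fact m)"
      by (rule sum_le_suminf) (use sums_summable[OF s] in auto)
    then show "(\<Sum>m<?k. ?x ^ m / fact m) \<le> exp ?x" using sums_unique[OF s] by simp
  qed simp
  finally show ?thesis unfolding layer_1[OF assms(3)] .
qed

lemma sum_merge:
  fixes f :: "'a set \<Rightarrow> real"
  assumes "finite P" "A \<in> P" "B \<in> P" "A \<noteq> B" "A \<union> B \<notin> P - {A, B}"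
  shows "sum f (insert (A \<union> B) (P - {A, B})) = sum f P - f A - f B + f (A \<union> B)"
proof -
  define Q where "Q = P - {A, B}"
  have Q: "finite Q" "A \<notin> insert B Q" "B \<notin> Q" "A \<union> B \<notin> Q"
    using assms(1,4,5) by (auto simp: Q_def)
  have "P = insert A (insert B Q)" using assms(2,3) by (auto simp: Q_def)
  then have "sum f P = f A + (f B + sum f Q)" using Q by simp
  then show ?thesis unfolding Q_def[symmetric] using Q by simp
qed

section \<open>Extensions with two components\<close>

text \<open>
  The closed form of the sum of \<^const>\<open>coarse_weight\<close> over the coarsenings into two blocks
  (a Hurwitz-type identity), obtained by solving the recursion for small numbers of components.
\<close>

definition two_layer_weight :: "'a set \<Rightarrow> 'a set set \<Rightarrow> real" where
  "two_layer_weight V P = (\<Prod>A\<in>P. real (card A)) * real (card V) ^ card P / (real (card V))\<^sup>2 *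
     ((\<Sum>A\<in>P. 1 / real (card A)) / real (card V) -
      (real (card P) - 2) * (real (card P) - 3) / (2 * (real (card V))\<^sup>2))"

text \<open>These are the three sums over separated pairs that appear when
  \<open>two_layer_weight\<close> is inserted into the recursion.\<close>

lemma sum_non_connected_pairs:
  assumes "finite V" "E \<in> simple_arcs V" "V \<noteq> {}"
  defines "c \<equiv> \<lambda>u. real (card (cls E u))" and "k \<equiv> real (card (comps V E))"
    and "n \<equiv> real (card V)" and "S \<equiv> (\<Sum>A\<in>comps V E. 1 / real (card A))"
  shows "(\<Sum>(u, v) \<in> V \<times> V - E\<^sup>*. 1 / c u + 1 / c v) = 2 * n * (k - 1)"
    and "(\<Sum>(u, v) \<in> V \<times> V - E\<^sup>*. 1 / (c u)\<^sup>2 + 1 / (c v)\<^sup>2) = 2 * (n * S - k)"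
    and "(\<Sum>(u, v) \<in> V \<times> V - E\<^sup>*. 1 / (c u * c v)) = k * (k - 1)"
proof -
  have closed: "\<And>u. u \<in> V \<Longrightarrow> cls E u \<subseteq> V" using cls_subset[OF simple_arcsD(1)[OF assms(2)]] .
  then have allP: "{A \<in> comps V E. A \<subseteq> V} = comps V E" by (auto simp: comps_def)
  have c0: "c u \<noteq> 0" if "u \<in> V" for u using card_cls_pos[OF assms(1,2) that] by (simp add: c_def)
  have sc: "(\<Sum>A\<in>comps V E. g A) = (\<Sum>u\<in>V. g (cls E u) / c u)" for g :: "'a set \<Rightarrow> real"
    using sum_over_comps[OF assms(1,2) subset_refl closed, of g] allP by (simp add: c_def)
  have k: "(\<Sum>u\<in>V. 1 / c u) = k" using sc[of "\<lambda>_. 1"] by (simp add: k_def)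
  have S: "(\<Sum>u\<in>V. 1 / (c u)\<^sup>2) = S"
    using sc[of "\<lambda>A. 1 / real (card A)"] by (simp add: S_def c_def power2_eq_square)
  have both: "(\<Sum>(u, v) \<in> V \<times> V - E\<^sup>*. g u + g v) = 2 * (\<Sum>u\<in>V. g u * (n - c u))" for g
  proof -
    have "(\<Sum>(u, v) \<in> V \<times> V - E\<^sup>*. g u + g v) =
        (\<Sum>(u, v) \<in> V \<times> V - E\<^sup>*. g u) + (\<Sum>(u, v) \<in> V \<times> V - E\<^sup>*. g v)"
      by (simp add: case_prod_unfold sum.distrib)
    then show ?thesis
      using sum_pairs_snd[OF simple_arcsD(2)[OF assms(2)], of g V] sum_pairs_fst[OF assms(1) closed, of g]
      by (simp add: c_def n_def)
  qed
  have "(\<Sum>u\<in>V. 1 / c u * (n - c u)) = (\<Sum>u\<in>V. n * (1 / c u) - 1)"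
    by (rule sum.cong) (use c0 in \<open>auto simp: field_simps\<close>)
  also have "\<dots> = n * k - n" by (simp add: sum_subtractf k n_def flip: sum_distrib_left del: times_divide_eq_right)
  finally show "(\<Sum>(u, v) \<in> V \<times> V - E\<^sup>*. 1 / c u + 1 / c v) = 2 * n * (k - 1)"
    unfolding both[of "\<lambda>u. 1 / c u"] by (simp add: algebra_simps)
  have "(\<Sum>u\<in>V. 1 / (c u)\<^sup>2 * (n - c u)) = (\<Sum>u\<in>V. n * (1 / (c u)\<^sup>2) - 1 / c u)"
    by (rule sum.cong) (use c0 in \<open>auto simp: field_simps power2_eq_square\<close>)
  also have "\<dots> = n * S - k" by (simp add: sum_subtractf S k flip: sum_distrib_left del: times_divide_eq_right)
  finally show "(\<Sum>(u, v) \<in> V \<times> V - E\<^sup>*. 1 / (c u)\<^sup>2 + 1 / (c v)\<^sup>2) = 2 * (n * S - k)"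
    unfolding both[of "\<lambda>u. 1 / (c u)\<^sup>2"] by simp
  have "V \<times> V - E\<^sup>* = (SIGMA u:V. V - cls E u)" by (auto simp: cls_def)
  then have "(\<Sum>(u, v) \<in> V \<times> V - E\<^sup>*. 1 / (c u * c v)) = (\<Sum>u\<in>V. \<Sum>v\<in>V - cls E u. 1 / (c u * c v))"
    using assms(1) sum.Sigma[of V "\<lambda>u. V - cls E u" "\<lambda>u v. 1 / (c u * c v)"] by simp
  also have "\<dots> = (\<Sum>u\<in>V. 1 / c u * (k - 1))"
  proof (rule sum.cong)
    fix u assume u: "u \<in> V"
    have "(\<Sum>v\<in>cls E u. 1 / c v) = (\<Sum>v\<in>cls E u. 1 / c u)"
      using cls_eqI[OF simple_arcsD(2)[OF assms(2)]] by (intro sum.cong) (auto simp: c_def)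
    also have "\<dots> = 1" using c0[OF u] by (simp add: c_def)
    finally have "(\<Sum>v\<in>V - cls E u. 1 / c v) = k - 1"
      using sum_diff[OF assms(1) closed[OF u], of "\<lambda>v. 1 / c v"] k by simp
    moreover have "(\<Sum>v\<in>V - cls E u. 1 / (c u * c v)) = 1 / c u * (\<Sum>v\<in>V - cls E u. 1 / c v)"
      by (simp add: sum_distrib_left)
    ultimately show "(\<Sum>v\<in>V - cls E u. 1 / (c u * c v)) = 1 / c u * (k - 1)" by simp
  qed simp
  also have "\<dots> = k * (k - 1)" using k by (simp flip: sum_distrib_right del: times_divide_eq_left)
  finally show "(\<Sum>(u, v) \<in> V \<times> V - E\<^sup>*. 1 / (c u * c v)) = k * (k - 1)" .
qed

text \<open>Merging parts of sizes \<open>a\<close> and \<open>b\<close> puts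
  \<open>1 / (a + b)\<close> into the sum of reciprocals. Multiplied by \<open>1 / a + 1 / b\<close>
  it becomes \<open>1 / (a b)\<close>, so the merged weight is a linear combination of the summands
  in \<open>sum_non_connected_pairs\<close>.\<close>

lemma two_layer_weight_step:
  fixes W n k S q a b :: real
  assumes "a \<noteq> 0" "b \<noteq> 0" "a + b \<noteq> 0"
  shows "W * (1 / a + 1 / b) * q * ((S - 1 / a - 1 / b + 1 / (a + b)) / n - d) =
    W * q * ((S / n - d) * (1 / a + 1 / b) - (1 / a\<^sup>2 + 1 / b\<^sup>2) / n - 1 / (a * b) / n)"
proof -
  have "(1 / a + 1 / b) * (1 / (a + b)) = 1 / (a * b)" using assms by (simp add: field_simps)
  then have "(1 / a + 1 / b) * (S - 1 / a - 1 / b + 1 / (a + b)) =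
      S * (1 / a + 1 / b) - (1 / a\<^sup>2 + 1 / b\<^sup>2) - 1 / (a * b)"
    by (simp add: algebra_simps power2_eq_square add_divide_distrib)
  then have "W * q * ((1 / a + 1 / b) * (S - 1 / a - 1 / b + 1 / (a + b)) / n - (1 / a + 1 / b) * d) =
      W * q * ((S * (1 / a + 1 / b) - (1 / a\<^sup>2 + 1 / b\<^sup>2) - 1 / (a * b)) / n - (1 / a + 1 / b) * d)"
    by simp
  then show ?thesis by (simp add: algebra_simps diff_divide_distrib add_divide_distrib)
qed

text \<open>Induction on the number \<open>k\<close> of components through
  \<open>bridge_exts_recursion\<close>. For \<open>k = 2\<close> only \<open>H\<close> itself counts
  and the correction term vanishes; otherwise each extension has \<open>2 (k - 2)\<close> new arcs,
  and this factor is nonzero.\<close>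

lemma card_layer_2:
  assumes "finite V" "H \<in> simple_arcs V" "V \<noteq> {}" "2 \<le> card (comps V H)"
  shows "real (card (layer V H 2)) = two_layer_weight V (comps V H)"
  using assms(2,4)
proof (induction "card (comps V H)" arbitrary: H rule: less_induct)
  case less
  note H = simple_arcsD[OF less.prems(1)]
  let ?P = "comps V H"
  let ?c = "\<lambda>u. real (card (cls H u))"
  define W where "W = (\<Prod>A\<in>?P. real (card A))"
  define S where "S = (\<Sum>A\<in>?P. 1 / real (card A))"
  define n where "n = real (card V)"
  define k where "k = real (card ?P)"
  have n0: "n \<noteq> 0" using assms(1,3) by (simp add: n_def)
  have finP: "finite ?P" using finite_comps[OF assms(1)] .
  show ?case
  proof (cases "card ?P = 2")
    case True
    have layer: "layer V H 2 = {H}"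
      using bridge_exts_same_comps[OF assms(1) less.prems(1)] True by (simp add: layer_def)
    obtain A B where AB: "?P = {A, B}" "A \<noteq> B" using True by (meson card_2_iff)
    have pos: "0 < card A" "0 < card B" using card_comp_pos[OF assms(1) less.prems(1)] AB(1) by auto
    have "A \<union> B = V" using Union_comps[OF H(1)] AB(1) by simp
    moreover have "A \<inter> B = {}" using comps_disjoint[OF H(2), of A V B] AB by auto
    ultimately have cV: "card V = card A + card B"
      using pos card_Un_disjoint[of A B] by (metis card_ge_0_finite)
    have "two_layer_weight V ?P = 1"
    proof -
      let ?x = "real (card A)" and ?y = "real (card B)"
      have xy: "0 < ?x" "0 < ?y" using pos by auto
      have "1 / ?x + 1 / ?y = (?x + ?y) / (?x * ?y)" using xy by (simp add: field_simps)
      then have "?x * ?y * ((1 / ?x + 1 / ?y) / (?x + ?y)) = 1" using xy by simp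
      moreover have "two_layer_weight V ?P = ?x * ?y * ((1 / ?x + 1 / ?y) / (?x + ?y))"
      proof -
        have "(?x + ?y)\<^sup>2 \<noteq> 0" using xy by simp
        then show ?thesis using AB True by (simp add: two_layer_weight_def cV power2_eq_square)
      qed
      ultimately show ?thesis by (simp only:)
    qed
    then show ?thesis using layer by simp
  next
    case False
    then have k3: "3 \<le> card ?P" using less.prems(2) by simp
    let ?X = "{E. card (comps V E) = 2}"
    have Int: "bridge_exts V H \<inter> ?X = layer V H 2" for H by (auto simp: layer_def)
    \<comment> \<open>\<open>q\<close> and \<open>d\<close> are the power and the correction term of
      \<open>two_layer_weight\<close> after a merge, that is, with \<open>k - 1\<close>
      components.\<close>
    define q where "q = n ^ (card ?P - 1) / n\<^sup>2"
    define d where "d = (k - 3) * (k - 4) / (2 * n\<^sup>2)"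
    have step: "real (card (layer V (add_edge H u v) 2)) =
        W * q * ((S / n - d) * (1 / ?c u + 1 / ?c v) - (1 / (?c u)\<^sup>2 + 1 / (?c v)\<^sup>2) / n - 1 / (?c u * ?c v) / n)"
      if uv: "(u, v) \<in> V \<times> V - H\<^sup>*" for u v
    proof -
      have V: "u \<in> V" "v \<in> V" using uv by auto
      have ne: "u \<noteq> v" using uv by auto
      have clsne: "cls H u \<noteq> cls H v" using uv cls_eq_iff[OF H(2)] by auto
      have mem: "cls H u \<in> ?P" "cls H v \<in> ?P" using V by (auto simp: comps_def)
      have disjuv: "cls H u \<inter> cls H v = {}" using comps_disjoint[OF H(2) mem] clsne by blast
      have notin: "cls H u \<union> cls H v \<notin> ?P - {cls H u, cls H v}"
        using comps_disjoint[OF H(2) _ mem(1), of "cls H u \<union> cls H v" u] cls_refl[of u H] by blast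
      have eq: "comps V (add_edge H u v) = insert (cls H u \<union> cls H v) (?P - {cls H u, cls H v})"
        using comps_add_edge[OF H(2) V] .
      have cc: "card (comps V (add_edge H u v)) = card ?P - 1"
        using card_comps_add_edge[OF H(2) V _ assms(1)] uv by auto
      have pos: "0 < card (cls H u)" "0 < card (cls H v)"
        using card_cls_pos[OF assms(1) less.prems(1)] V by auto
      have cU: "card (cls H u \<union> cls H v) = card (cls H u) + card (cls H v)"
        using disjuv pos by (simp add: card_Un_disjoint card_ge_0_finite)
      have "real (card (layer V (add_edge H u v) 2)) = two_layer_weight V (comps V (add_edge H u v))"
        using less.hyps[OF _ add_edge_simple[OF less.prems(1) V ne]] cc k3 by simp
      also have "\<dots> = W * (1 / ?c u + 1 / ?c v) * q *
          ((S - 1 / ?c u - 1 / ?c v + 1 / (?c u + ?c v)) / n - d)"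
      proof -
        have 1: "(\<Prod>A\<in>comps V (add_edge H u v). real (card A)) = W * (1 / ?c u + 1 / ?c v)"
          unfolding eq W_def
          using prod_merge[OF finP mem clsne notin, of "\<lambda>A. real (card A)"] pos cU
          by (simp add: field_simps)
        have 2: "(\<Sum>A\<in>comps V (add_edge H u v). 1 / real (card A)) =
            S - 1 / ?c u - 1 / ?c v + 1 / (?c u + ?c v)"
          unfolding eq S_def
          using sum_merge[OF finP mem clsne notin, of "\<lambda>A. 1 / real (card A)"] cU by simp
        have 3: "real (card ?P - 1) = k - 1" using k3 by (simp add: k_def of_nat_diff)
        show ?thesis
          unfolding two_layer_weight_def 1 2 cc 3 q_def d_def n_def by (simp add: algebra_simps)
      qed
      also have "\<dots> = W * q * ((S / n - d) * (1 / ?c u + 1 / ?c v) -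
          (1 / (?c u)\<^sup>2 + 1 / (?c v)\<^sup>2) / n - 1 / (?c u * ?c v) / n)"
        by (rule two_layer_weight_step) (use pos in auto)
      finally show ?thesis .
    qed
    have "(\<Sum>E \<in> layer V H 2. real (card (E - H))) =
        (\<Sum>(u, v) \<in> V \<times> V - H\<^sup>*. real (card (layer V (add_edge H u v) 2)))"
      using arg_cong[OF bridge_exts_recursion[OF assms(1) less.prems(1), of ?X], of real]
      by (simp add: case_prod_unfold Int)
    also have "\<dots> = (\<Sum>(u, v) \<in> V \<times> V - H\<^sup>*. W * q * ((S / n - d) * (1 / ?c u + 1 / ?c v) -
        (1 / (?c u)\<^sup>2 + 1 / (?c v)\<^sup>2) / n - 1 / (?c u * ?c v) / n))"
      by (rule sum.cong) (use step in auto)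
    also have "\<dots> = W * q * ((S / n - d) * (\<Sum>(u, v) \<in> V \<times> V - H\<^sup>*. 1 / ?c u + 1 / ?c v) -
        (\<Sum>(u, v) \<in> V \<times> V - H\<^sup>*. 1 / (?c u)\<^sup>2 + 1 / (?c v)\<^sup>2) / n -
        (\<Sum>(u, v) \<in> V \<times> V - H\<^sup>*. 1 / (?c u * ?c v)) / n)"
      by (simp only: case_prod_unfold sum_distrib_left sum_subtractf[symmetric] sum_divide_distrib)
    also have "\<dots> = W * q * ((S / n - d) * (2 * n * (k - 1)) - 2 * (n * S - k) / n - k * (k - 1) / n)"
      using sum_non_connected_pairs[OF assms(1) less.prems(1) assms(3)]
      unfolding n_def[symmetric] k_def[symmetric] S_def[symmetric] by simp
    \<comment> \<open>The closed form reproduces itself because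
      \<open>(k - 1) (k - 4) + k = (k - 2)^2\<close>.\<close>
    also have "\<dots> = W * q * (2 * (k - 2)) * (S - (k - 2) * (k - 3) / (2 * n))"
      using n0 by (simp add: d_def field_simps power2_eq_square)
    also have "\<dots> = (2 * (k - 2)) * (W * (q * n) * (S / n - (k - 2) * (k - 3) / (2 * n\<^sup>2)))"
      using n0 by (simp add: field_simps power2_eq_square)
    also have "q * n = n ^ card ?P / n\<^sup>2"
      using k3 by (simp add: q_def power_minus_mult flip: power_Suc2)
    also have "W * \<dots> * (S / n - (k - 2) * (k - 3) / (2 * n\<^sup>2)) = two_layer_weight V ?P"
      by (simp add: two_layer_weight_def W_def n_def S_def k_def)
    finally have "(\<Sum>E \<in> layer V H 2. real (card (E - H))) = (2 * (k - 2)) * two_layer_weight V ?P" .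
    moreover have "(\<Sum>E \<in> layer V H 2. real (card (E - H))) = (\<Sum>E \<in> layer V H 2. 2 * (k - 2))"
    proof (rule sum.cong)
      fix E assume "E \<in> layer V H 2"
      then have "card (E - H) + 4 = 2 * card ?P" by (auto simp: layer_def bridge_exts_def)
      then have "real (card (E - H)) + 4 = 2 * real (card ?P)"
        by (metis of_nat_add of_nat_mult of_nat_numeral)
      then show "real (card (E - H)) = 2 * (k - 2)" by (simp add: k_def)
    qed simp
    ultimately have "(2 * (k - 2)) * real (card (layer V H 2)) = (2 * (k - 2)) * two_layer_weight V ?P"
      by simp
    moreover have "2 * (k - 2) \<noteq> 0" using k3 by (simp add: k_def)
    ultimately show ?thesis by (metis mult_cancel_left)
  qed
qed

text \<open>For isolated vertices both the number of parts and the sum of reciprocals are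
  \<open>n\<close>, so the two-component forests number \<open>1 - (n - 2) (n - 3) / (2 n^2)\<close>
  times the trees, hence at least half as many.\<close>

lemma bridge_exts_empty_ge:
  assumes "finite V" "2 \<le> card V"
  shows "3 / 2 * real (card (connected_exts V {})) \<le> real (card (bridge_exts V {}))"
proof -
  have V: "V \<noteq> {}" using assms(2) by auto
  define n where "n = real (card V)"
  have n: "2 \<le> n" using assms(2) by (simp add: n_def)
  have prod1: "(\<Prod>A\<in>comps V {}. real (card A)) = 1" by (rule prod.neutral) (auto simp: comps_empty)
  have sum1: "(\<Sum>A\<in>comps V {}. 1 / real (card A)) = n"
    by (simp add: comps_empty sum.reindex n_def)
  have conn: "real (card (connected_exts V {})) = n ^ card V / n\<^sup>2"
    using card_connected_exts[OF assms(1) empty_simple V] prod1 by (simp add: card_comps_empty n_def)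
  have "real (card (layer V {} 2)) = n ^ card V / n\<^sup>2 * (1 - (n - 2) * (n - 3) / (2 * n\<^sup>2))"
    using card_layer_2[OF assms(1) empty_simple V] assms(2) n
    unfolding two_layer_weight_def prod1 sum1 card_comps_empty n_def[symmetric] by simp
  also have "\<dots> \<ge> n ^ card V / n\<^sup>2 * (1 / 2)"
  proof (rule mult_left_mono)
    have "(n - 2) * (n - 3) \<le> n\<^sup>2" using n by (simp add: algebra_simps power2_eq_square)
    then show "1 / 2 \<le> 1 - (n - 2) * (n - 3) / (2 * n\<^sup>2)" using n by (simp add: field_simps)
  qed (use n in simp)
  finally have "1 / 2 * real (card (connected_exts V {})) \<le> real (card (layer V {} 2))"
    unfolding conn by simp
  moreover have "card (connected_exts V {}) + card (layer V {} 2) \<le> card (bridge_exts V {})"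
  proof -
    have "connected_exts V {} \<inter> layer V {} 2 = {}" unfolding layer_1[OF V, symmetric] by (auto simp: layer_def)
    then have "card (connected_exts V {}) + card (layer V {} 2) = card (connected_exts V {} \<union> layer V {} 2)"
      using finite_layer[OF assms(1)] by (simp add: card_Un_disjoint flip: layer_1[OF V])
    also have "\<dots> \<le> card (bridge_exts V {})"
      using finite_bridge_exts[OF assms(1)]
      by (intro card_mono) (auto simp: layer_def connected_exts_def)
    finally show ?thesis .
  qed
  ultimately show ?thesis by linarith
qed

text \<open>The bound \<open>1 + x + x^2\<close> at \<open>x = 2 / 5\<close> is \<open>1.56\<close>,
  which is too large. At \<open>x = 1 / 80\<close> it is sharp enough to survive the 32nd power, and
  \<open>32 / 80 = 2 / 5\<close>.\<close>

lemma exp_two_fifths_le: "exp (2 / 5 :: real) \<le> 3 / 2"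
proof -
  have "exp (1 / 80 :: real) \<le> 1 + 1 / 80 + (1 / 80)\<^sup>2" by (rule exp_bound) auto
  then have "exp (1 / 80 :: real) ^ 32 \<le> (1 + 1 / 80 + (1 / 80)\<^sup>2) ^ 32" by (rule power_mono) simp
  also have "\<dots> \<le> 3 / 2" by (simp add: power2_eq_square field_simps)
  finally show ?thesis by (simp flip: exp_of_nat_mult)
qed

lemma bridge_exts_ratio_bound:
  assumes "finite V" "H \<in> simple_arcs V" "V \<noteq> {}"
  obtains t where "2 / 5 * real (card V) \<le> real t" "t \<le> card V" "0 < t"
    "real (card (bridge_exts V H)) / card (connected_exts V H) \<le>
      real (card (bridge_exts {1..t} {})) / card (connected_exts {1..t} ({} :: nat rel))"
proof (cases "2 / 5 * real (card V) \<le> card (comps V H)")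
  case True
  have "0 < card (comps V H)"
    using finite_comps[OF assms(1)] assms(3) by (auto simp: card_gt_0_iff comps_def)
  then show ?thesis
    using that[OF True card_comps_le_card[OF assms(1)]]
      bridge_exts_ratio_le[OF assms, of "{1..card (comps V H)}"] by simp
next
  case False
  let ?n = "card V"
  have n0: "0 < ?n" using assms by (simp add: card_gt_0_iff)
  have "0 < card (comps V H)"
    using finite_comps[OF assms(1)] assms(3) by (auto simp: card_gt_0_iff comps_def)
  \<comment> \<open>From \<open>1 \<le> k\<close> and \<open>k < 2 n / 5\<close>. This excludes
    \<open>n = 1\<close>, where the forest ratio is only \<open>1\<close>.\<close>
  then have n2: "2 \<le> ?n" using False by linarith
  have pos: "0 < real (card (connected_exts V H))"
    unfolding card_connected_exts[OF assms] using comps_prod_pos[OF assms(1,2)] n0 by simp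
  have posW: "0 < real (card (connected_exts {1..?n} ({} :: nat rel)))"
    using card_connected_exts[of "{1..?n}", OF _ empty_simple] comps_prod_pos[of "{1..?n}", OF _ empty_simple] n0
    by simp
  have "real (card (comps V H)) / real ?n \<le> 2 / 5" using False n0 by (simp add: field_simps)
  then have "exp (real (card (comps V H)) / real ?n) \<le> 3 / 2"
    using exp_two_fifths_le by (metis exp_le_cancel_iff order_trans)
  then have "exp (real (card (comps V H)) / real ?n) * real (card (connected_exts V H)) \<le>
      3 / 2 * real (card (connected_exts V H))"
    by (rule mult_right_mono) simp
  then have "real (card (bridge_exts V H)) \<le> 3 / 2 * real (card (connected_exts V H))"
    using bridge_exts_exp_bound[OF assms] by linarith
  then have "real (card (bridge_exts V H)) / card (connected_exts V H) \<le> 3 / 2"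
    using pos by (simp add: divide_le_eq)
  also have "\<dots> \<le> real (card (bridge_exts {1..?n} {})) / card (connected_exts {1..?n} ({} :: nat rel))"
    using bridge_exts_empty_ge[of "{1..?n}"] n2 posW by (simp add: le_divide_eq)
  finally show ?thesis using that[of ?n] n0 by simp
qed

section \<open>Bridges of graphs and the bridgeless core\<close>

definition del_edge :: "'a rel \<Rightarrow> 'a \<times> 'a \<Rightarrow> 'a rel" where
  "del_edge E a = E - {a, prod.swap a}"

definition bridges :: "'a set \<Rightarrow> 'a rel \<Rightarrow> ('a \<times> 'a) set" where
  "bridges V E = {a \<in> E. card (comps V E) < card (comps V (del_edge E a))}"

text \<open>All bridges are removed at once; \<open>core_del_bridge\<close> shows that removing them
  one after another leads to the same graph.\<close>

definition core :: "'a set \<Rightarrow> 'a rel \<Rightarrow> 'a rel" where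
  "core V E = E - bridges V E"

lemma del_edge_simple: "E \<in> simple_arcs V \<Longrightarrow> del_edge E a \<in> simple_arcs V"
  by (cases a) (auto simp: simple_arcs_def del_edge_def sym_def irrefl_def)

lemma add_del_edge:
  assumes "sym E" "(u, v) \<in> E" shows "add_edge (del_edge E (u, v)) u v = E"
  using assms by (auto simp: add_edge_def del_edge_def dest: symD)

lemma mem_bridges_iff:
  assumes "finite V" "E \<in> simple_arcs V" "(u, v) \<in> E"
  shows "(u, v) \<in> bridges V E \<longleftrightarrow> (u, v) \<notin> (del_edge E (u, v))\<^sup>*"
proof -
  note E = simple_arcsD[OF assms(2)]
  note D = simple_arcsD[OF del_edge_simple[OF assms(2), of "(u, v)"]]
  have V: "u \<in> V" "v \<in> V" using assms(3) E(1) by auto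
  note ad = add_del_edge[OF E(2) assms(3)]
  show ?thesis
    using card_comps_add_edge[OF D(2) V _ assms(1)]
      comps_add_edge_same[OF D(2), of u v V] assms(3)
    unfolding ad bridges_def by auto
qed

lemma card_comps_del_edge:
  assumes "finite V" "E \<in> simple_arcs V" "a \<in> E"
  shows "card (comps V (del_edge E a)) \<le> Suc (card (comps V E))"
proof -
  obtain u v where a: "a = (u, v)" by fastforce
  note E = simple_arcsD[OF assms(2)]
  have V: "u \<in> V" "v \<in> V" using assms(3) E(1) a by auto
  show ?thesis
    using card_comps_add_edge_le[OF simple_arcsD(2)[OF del_edge_simple[OF assms(2)]] V assms(1)]
      add_del_edge[OF E(2)] assms(3) a by metis
qed

lemma card_comps_del_bridge:
  assumes "finite V" "E \<in> simple_arcs V" "a \<in> bridges V E"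
  shows "card (comps V (del_edge E a)) = Suc (card (comps V E))"
proof -
  have "a \<in> E" "card (comps V E) < card (comps V (del_edge E a))"
    using assms(3) by (auto simp: bridges_def)
  then show ?thesis using card_comps_del_edge[OF assms(1,2)] by (metis Suc_leI le_antisym)
qed

lemma bridges_swap:
  assumes "E \<in> simple_arcs V" "a \<in> bridges V E"
  shows "prod.swap a \<in> bridges V E"
  using assms by (cases a) (auto simp: bridges_def del_edge_def simple_arcs_def insert_commute dest: symD)

text \<open>A bridge stays a bridge in a subgraph that contains it. Conversely, if \<open>b\<close>
  is a bridge after the bridge \<open>a\<close> is deleted, deleting both creates two new
  components; deleting \<open>a\<close> accounts for at most one of them, so deleting
  \<open>b\<close> alone creates one.\<close>

lemma bridges_del_bridge:
  assumes "finite V" "E \<in> simple_arcs V" "a \<in> bridges V E"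
  shows "bridges V (del_edge E a) = bridges V E - {a, prod.swap a}"
proof -
  have "b \<in> bridges V (del_edge E a) \<longleftrightarrow> b \<in> bridges V E"
    if b: "b \<in> E" "b \<noteq> a" "b \<noteq> prod.swap a" for b
  proof
    obtain x y where xy: "b = (x, y)" by fastforce
    have bD: "b \<in> del_edge E a" using b by (simp add: del_edge_def)
    have sub: "del_edge (del_edge E a) b \<subseteq> del_edge E b" by (auto simp: del_edge_def)
    show "b \<in> bridges V (del_edge E a)" if "b \<in> bridges V E"
      using that mem_bridges_iff[OF assms(1,2), of x y] mem_bridges_iff[OF assms(1) del_edge_simple[OF assms(2)], of x y a]
        b(1) bD rtrancl_mono[OF sub] unfolding xy by auto
    assume bb: "b \<in> bridges V (del_edge E a)"
    have aE: "a \<in> E" using assms(3) by (simp add: bridges_def)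
    have comm: "del_edge (del_edge E a) b = del_edge (del_edge E b) a" by (auto simp: del_edge_def)
    have aD: "a \<in> del_edge E b" using aE b by (cases a; cases b) (auto simp: del_edge_def)
    have "card (comps V (del_edge (del_edge E b) a)) = Suc (Suc (card (comps V E)))"
      using card_comps_del_bridge[OF assms(1) del_edge_simple[OF assms(2)] bb]
        card_comps_del_bridge[OF assms] comm by simp
    then have "card (comps V E) < card (comps V (del_edge E b))"
      using card_comps_del_edge[OF assms(1) del_edge_simple[OF assms(2)] aD] by simp
    then show "b \<in> bridges V E" using b(1) by (simp add: bridges_def)
  qed
  moreover have "bridges V (del_edge E a) \<subseteq> del_edge E a" "bridges V E \<subseteq> E"
    by (auto simp: bridges_def)
  ultimately show ?thesis by (auto simp: del_edge_def)
qed

lemma core_del_bridge: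
  assumes "finite V" "E \<in> simple_arcs V" "a \<in> bridges V E"
  shows "core V (del_edge E a) = core V E"
  using bridges_swap[OF assms(2,3)] assms(3)
  unfolding core_def bridges_del_bridge[OF assms] by (auto simp: del_edge_def)

lemma card_del_edge_less:
  assumes "finite V" "E \<in> simple_arcs V" "a \<in> bridges V E"
  shows "card (del_edge E a) < card E"
  using assms finite_arcs[OF assms(1,2)]
  by (intro psubset_card_mono) (auto simp: bridges_def del_edge_def)

text \<open>Bridge-alterability speaks of one bridge at a time, so facts about \<open>core\<close>
  are carried along successive deletions.\<close>

lemma del_bridge_induct [consumes 2, case_names bridgeless bridge]:
  assumes "finite V" "E \<in> simple_arcs V"
    and "\<And>E. E \<in> simple_arcs V \<Longrightarrow> bridges V E = {} \<Longrightarrow> P E"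
    and "\<And>E a. E \<in> simple_arcs V \<Longrightarrow> a \<in> bridges V E \<Longrightarrow> P (del_edge E a) \<Longrightarrow> P E"
  shows "P E"
  using assms(2)
proof (induction "card E" arbitrary: E rule: less_induct)
  case less
  show ?case
  proof (cases "bridges V E = {}")
    case False
    then obtain a where a: "a \<in> bridges V E" by blast
    then show ?thesis
      using assms(4)[OF less.prems a] less.hyps[OF card_del_edge_less[OF assms(1) less.prems a]
          del_edge_simple[OF less.prems]] by blast
  qed (use assms(3) less.prems in blast)
qed

lemma del_edge_in_bridge_exts_iff:
  assumes "finite V" "E \<in> simple_arcs V" "H \<subseteq> del_edge E a" "a \<in> bridges V E"
  shows "del_edge E a \<in> bridge_exts V H \<longleftrightarrow> E \<in> bridge_exts V H"
proof -
  obtain u v where a: "a = (u, v)" by fastforce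
  note E = simple_arcsD[OF assms(2)]
  have uv: "(u, v) \<in> E" "(v, u) \<in> E" using assms(4) E(2) by (auto simp: bridges_def a dest: symD)
  have ne: "u \<noteq> v" using uv E(3) by (auto simp: irrefl_def)
  have nH: "(u, v) \<notin> H" "(v, u) \<notin> H" using assms(3) by (auto simp: del_edge_def a)
  have "card (E - H) = card (E - add_edge H u v) + 2"
    using card_Diff_add_edge[OF finite_arcs[OF assms(1,2)] uv nH ne] .
  moreover have "E - add_edge H u v = del_edge E a - H" by (auto simp: add_edge_def del_edge_def a)
  ultimately have "card (E - H) = card (del_edge E a - H) + 2" by simp
  moreover have "H \<subseteq> E" using assms(3) by (auto simp: del_edge_def)
  ultimately show ?thesis
    using assms(2,3) del_edge_simple[OF assms(2), of a] card_comps_del_bridge[OF assms(1,2,4)]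
    by (auto simp: bridge_exts_def)
qed

lemma core_bridgeless:
  assumes "finite V" "E \<in> simple_arcs V"
  shows "core V E \<in> simple_arcs V \<and> bridges V (core V E) = {} \<and> E \<in> bridge_exts V (core V E)"
  using assms
proof (induction rule: del_bridge_induct)
  case (bridgeless E)
  then show ?case by (simp add: core_def bridge_exts_def)
next
  case (bridge E a)
  note core = core_del_bridge[OF assms(1) bridge(1,2)]
  have "core V E \<subseteq> del_edge E a" unfolding core[symmetric] by (auto simp: core_def)
  then show ?case
    using bridge(3) del_edge_in_bridge_exts_iff[OF assms(1) bridge(1) _ bridge(2)]
    unfolding core by blast
qed

text \<open>The equality in \<open>bridge_exts\<close> leaves no slack: with two arcs fewer,
  \<open>card_comps_le\<close> forces an additional component.\<close>

lemma bridge_exts_arc_bridge: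
  assumes "finite V" "H \<in> simple_arcs V" "E \<in> bridge_exts V H" "a \<in> E - H"
  shows "a \<in> bridges V E"
proof -
  obtain u v where a: "a = (u, v)" by fastforce
  note X = bridge_extsD[OF assms(3)]
  note E = simple_arcsD[OF X(1)] and H = simple_arcsD[OF assms(2)]
  have uv: "(u, v) \<in> E" "(v, u) \<in> E" "(u, v) \<notin> H" "(v, u) \<notin> H"
    using assms(4) E(2) H(2) by (auto simp: a dest: symD)
  have ne: "u \<noteq> v" using uv E(3) by (auto simp: irrefl_def)
  have "card (E - H) = card (E - add_edge H u v) + 2"
    using card_Diff_add_edge[OF finite_arcs[OF assms(1) X(1)] uv ne] .
  moreover have "E - add_edge H u v = del_edge E a - H" by (auto simp: add_edge_def del_edge_def a)
  moreover have "H \<subseteq> del_edge E a" using X(2) uv by (auto simp: del_edge_def a)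
  ultimately have "card (comps V E) < card (comps V (del_edge E a))"
    using card_comps_le[OF assms(1) del_edge_simple[OF X(1)] assms(2)] X(3) by fastforce
  then show ?thesis using assms(4) by (simp add: bridges_def)
qed

text \<open>Deleting a bridge outside \<open>H\<close> stays among the extensions of
  \<open>H\<close> and keeps the core. A bridge of \<open>E\<close> inside \<open>H\<close> cannot
  occur, as it would also be a bridge of the subgraph \<open>H\<close>.\<close>

lemma core_bridge_exts:
  assumes "finite V" "H \<in> simple_arcs V" "bridges V H = {}" "E \<in> bridge_exts V H"
  shows "core V E = H"
proof -
  have "E \<in> simple_arcs V" using bridge_extsD(1)[OF assms(4)] .
  from assms(1) this assms(4) show ?thesis
  proof (induction rule: del_bridge_induct)
    case (bridgeless E)
    then have "E - H = {}" using bridge_exts_arc_bridge[OF assms(1,2), of E] by blast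
    then show ?case using bridgeless bridge_extsD(2)[of E V H] by (auto simp: core_def)
  next
    case (bridge E a)
    show ?case
    proof (cases "H \<subseteq> del_edge E a")
      case True
      then show ?thesis
        using bridge del_edge_in_bridge_exts_iff[OF assms(1) bridge(1) True bridge(2)]
          core_del_bridge[OF assms(1) bridge(1,2)] by simp
    next
      case False
      then obtain b where b: "b \<in> H" "b = a \<or> b = prod.swap a"
        using bridge_extsD(2)[OF bridge(4)] by (auto simp: del_edge_def)
      have bE: "b \<in> bridges V E" using b(2) bridge(2) bridges_swap[OF bridge(1,2)] by auto
      obtain u v where uv: "b = (u, v)" by fastforce
      have "(u, v) \<notin> (del_edge E b)\<^sup>*"
        using mem_bridges_iff[OF assms(1) bridge(1), of u v] bE uv by (auto simp: bridges_def)
      moreover have "del_edge H b \<subseteq> del_edge E b"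
        using bridge_extsD(2)[OF bridge(4)] by (auto simp: del_edge_def)
      ultimately have "(u, v) \<notin> (del_edge H b)\<^sup>*" using rtrancl_mono by blast
      then have "b \<in> bridges V H" using mem_bridges_iff[OF assms(1,2), of u v] b(1) uv by simp
      then show ?thesis using assms(3) by blast
    qed
  qed
qed

text \<open>Identifies the fibres of \<open>core\<close> with the sets that the preceding sections
  count.\<close>

lemma core_eq_iff:
  assumes "finite V" "H \<in> simple_arcs V" "bridges V H = {}"
  shows "{E \<in> simple_arcs V. core V E = H} = bridge_exts V H"
  using core_bridge_exts[OF assms] core_bridgeless[OF assms(1)] bridge_extsD(1) by blast

section \<open>Translation between library digraphs and arc relations\<close>

abbreviation graph_of :: "'a set \<Rightarrow> 'a rel \<Rightarrow> 'a pair_pre_digraph" where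
  "graph_of V E \<equiv> \<lparr>pverts = V, parcs = E\<rparr>"

lemma pair_graph_iff:
  "pair_graph G \<longleftrightarrow> finite (pverts G) \<and> parcs G \<in> simple_arcs (pverts G)"
proof
  assume "pair_graph G"
  then interpret pair_graph G .
  have "sym (parcs G)" using pair_sym_arcs by (simp add: Digraph.symmetric_def)
  moreover have "irrefl (parcs G)" using no_loops' by (auto simp: irrefl_def)
  moreover have "parcs G \<subseteq> pverts G \<times> pverts G" using wellformed' by auto
  ultimately show "finite (pverts G) \<and> parcs G \<in> simple_arcs (pverts G)"
    using pair_finite_verts by (simp add: simple_arcs_def)
next
  assume G: "finite (pverts G) \<and> parcs G \<in> simple_arcs (pverts G)"
  then have "finite (parcs G)" using finite_arcs by blast
  with G show "pair_graph G"
    by unfold_locales (auto simp: simple_arcs_def irrefl_def Digraph.symmetric_def)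
qed

lemma num_components_eq:
  assumes "finite V" "E \<in> simple_arcs V"
  shows "num_components (graph_of V E) = card (comps V E)"
proof -
  interpret pair_graph "graph_of V E" using assms by (simp add: pair_graph_iff)
  have "scc_of u = cls E u" if "u \<in> V" for u
    using that rtrancl_sym[OF simple_arcsD(2)[OF assms(2)]] cls_subset[OF simple_arcsD(1)[OF assms(2)] that]
    by (auto simp: scc_of_def reachable_conv cls_def)
  then have "sccs_verts = comps V E" unfolding sccs_verts_conv_scc_of comps_def by simp
  then show ?thesis unfolding num_components_def using card_sccs_verts by simp
qed

lemma connected_iff:
  assumes "finite V" "E \<in> simple_arcs V" "V \<noteq> {}"
  shows "Digraph_Component.connected (with_proj (graph_of V E)) \<longleftrightarrow> comps V E = {V}"
proof -
  interpret pair_graph "graph_of V E" using assms by (simp add: pair_graph_iff)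
  note E = simple_arcsD[OF assms(2)]
  \<comment> \<open>Library connectedness is strong connectedness of the symmetric closure, which
    changes nothing here; it also demands a nonempty vertex set.\<close>
  have "mk_symmetric (with_proj (graph_of V E)) = graph_of V E"
    using E(2) by (auto simp: mk_symmetric_def dest: symD)
  then have "Digraph_Component.connected (with_proj (graph_of V E)) \<longleftrightarrow> (\<forall>u\<in>V. \<forall>v\<in>V. v \<in> cls E u)"
    using assms(3) by (simp add: connected_def strongly_connected_def reachable_conv cls_def)
  also have "\<dots> \<longleftrightarrow> (\<forall>u\<in>V. cls E u = V)" using cls_subset[OF E(1)] by blast
  also have "\<dots> \<longleftrightarrow> comps V E = {V}" using assms(3) by (auto simp: comps_def)
  finally show ?thesis .
qed

lemma bridge_iff:
  assumes "finite V" "E \<in> simple_arcs V"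
  shows "bridge (graph_of V E) a \<longleftrightarrow> a \<in> bridges V E"
  using num_components_eq[OF assms] num_components_eq[OF assms(1) del_edge_simple[OF assms(2)]]
  by (simp add: bridge_def bridges_def delete_edge_def del_edge_def)

lemma core_mem_iff:
  assumes "bridge_alterable \<A>" "finite V" "E \<in> simple_arcs V"
  shows "graph_of V E \<in> \<A> \<longleftrightarrow> graph_of V (core V E) \<in> \<A>"
  using assms(2,3)
proof (induction rule: del_bridge_induct)
  case (bridgeless E)
  then show ?case by (simp add: core_def)
next
  case (bridge E a)
  have "graph_of V E \<in> \<A> \<longleftrightarrow> delete_edge (graph_of V E) a \<in> \<A>"
  proof -
    have "pair_graph (graph_of V E)" using assms(2) bridge(1) by (simp add: pair_graph_iff)
    moreover have "bridge (graph_of V E) a" using bridge(2) bridge_iff[OF assms(2) bridge(1)] by simp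
    ultimately show ?thesis using assms(1) unfolding bridge_alterable_def by blast
  qed
  then show ?case
    using bridge(3) core_del_bridge[OF assms(2) bridge(1,2)] by (simp add: delete_edge_def del_edge_def)
qed

section \<open>Bridges and cycles: forests as the block of the edgeless graph\<close>

lemma pcas_imp_rtrancl: "pcas u p v \<Longrightarrow> set p \<subseteq> R \<Longrightarrow> (u, v) \<in> R\<^sup>*"
  by (induction p arbitrary: u) (auto intro: converse_rtrancl_into_rtrancl)

lemma pcas_snoc: "pcas u p v \<Longrightarrow> pcas u (p @ [(v, w)]) w"
  by (induction p arbitrary: u) auto

lemma pawalk_verts_snoc: "pcas u p v \<Longrightarrow> pawalk_verts u (p @ [(v, w)]) = pawalk_verts u p @ [w]"
  by (induction p arbitrary: u) auto

lemma fst_in_pawalk_verts: "(a, b) \<in> set p \<Longrightarrow> a \<in> set (pawalk_verts u p)"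
  by (induction p arbitrary: u) auto

lemma pcas_last_in_verts: "pcas u p v \<Longrightarrow> v \<in> set (pawalk_verts u p)"
  by (induction p arbitrary: u) auto

text \<open>Tails of arcs fill every position of the vertex list but the last, which holds
  \<open>v\<close>.\<close>

lemma distinct_walk_end:
  "pcas u p v \<Longrightarrow> distinct (pawalk_verts u p) \<Longrightarrow> (a, b) \<in> set p \<Longrightarrow> a \<noteq> v"
proof (induction p arbitrary: u)
  case (Cons e p)
  then show ?case using pcas_last_in_verts[of "snd e" p v] by auto
qed simp

text \<open>The first arc of the cycle is no bridge: the rest of the cycle leads back from its head
  to its tail without using the edge in either direction.\<close>

lemma cycle_arc_not_bridge:
  assumes "finite V" "E \<in> simple_arcs V"
    and "pre_digraph.cycle (with_proj (graph_of V E)) p" "3 \<le> length p"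
  shows "\<exists>a\<in>E. a \<notin> bridges V E"
proof -
  interpret pair_graph "graph_of V E" using assms by (simp add: pair_graph_iff)
  obtain u where u: "awalk u p u" "distinct (tl (pawalk_verts u p))" using assms(3) by (auto simp: cycle_def)
  obtain e f q where p: "p = e # f # q" "q \<noteq> []"
    using assms(4) by (metis (no_types) One_nat_def Suc_le_length_iff length_0_conv list.size(3) not_one_le_zero numeral_3_eq_3)
  obtain w x where e: "e = (u, w)" and f: "f = (w, x)"
    using u(1) by (cases e; cases f) (auto simp: awalk_def p)
  have es: "pcas w (f # q) u" "set (f # q) \<subseteq> E" "(u, w) \<in> E" "distinct (pawalk_verts w (f # q))"
    using u by (auto simp: awalk_def p e f)
  have 1: "(u, w) \<notin> set (f # q)" using distinct_walk_end[OF es(1,4)] by blast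
  \<comment> \<open>Here the length of at least 3 enters: \<open>q\<close> is nonempty, so
    \<open>x\<close> is the tail of a further arc and not the end of the walk. A back-and-forth walk
    along one edge is thereby excluded.\<close>
  have "x \<noteq> u" using distinct_walk_end[OF es(1,4), of x] es(1) p(2) f by (cases q) force+
  moreover have "(w, u) \<notin> set q" using fst_in_pawalk_verts[of w u q x] es(4) f by auto
  ultimately have 2: "(w, u) \<notin> set (f # q)" using f by auto
  have "set (f # q) \<subseteq> del_edge E (u, w)" using es(2) 1 2 by (auto simp: del_edge_def)
  then have "(w, u) \<in> (del_edge E (u, w))\<^sup>*" using pcas_imp_rtrancl[OF es(1)] by blast
  then have "(u, w) \<in> (del_edge E (u, w))\<^sup>*"
    using rtrancl_sym[OF simple_arcsD(2)[OF del_edge_simple[OF assms(2)]]] by blast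
  then show ?thesis using mem_bridges_iff[OF assms(1,2) es(3)] es(3) by blast
qed

text \<open>A simple path from \<open>u\<close> to \<open>v\<close> in the graph without the edge is
  closed up by the arc \<open>(v, u)\<close>. The path has at least two arcs because
  \<open>(u, v)\<close> was deleted.\<close>

lemma not_bridge_imp_cycle:
  assumes "finite V" "E \<in> simple_arcs V" "a \<in> E" "a \<notin> bridges V E"
  shows "\<exists>p. pre_digraph.cycle (with_proj (graph_of V E)) p \<and> 3 \<le> length p"
proof -
  obtain u v where a: "a = (u, v)" by fastforce
  note E = simple_arcsD[OF assms(2)]
  have uv: "(u, v) \<in> E" "(v, u) \<in> E" "u \<noteq> v" "u \<in> V"
    using assms(3) E by (auto simp: a irrefl_def dest: symD)
  interpret G: pair_graph "graph_of V E" using assms by (simp add: pair_graph_iff)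
  interpret D: pair_graph "graph_of V (del_edge E a)"
    using assms(1) del_edge_simple[OF assms(2)] by (simp add: pair_graph_iff)
  have "(u, v) \<in> (del_edge E a)\<^sup>*" using mem_bridges_iff[OF assms(1,2) uv(1)] assms(4) a by simp
  then have "u \<rightarrow>\<^sup>*\<^bsub>with_proj (graph_of V (del_edge E a))\<^esub> v"
    using D.reachable_conv'[of u v] uv(4) by simp
  then obtain p where p: "D.apath u p v" using D.reachable_apath by blast
  have q: "set p \<subseteq> del_edge E a" "pcas u p v" "distinct (pawalk_verts u p)"
    using p by (auto simp: D.apath_def D.awalk_def)
  have "2 \<le> length p"
  proof (rule ccontr)
    assume "\<not> 2 \<le> length p"
    then consider "p = []" | e where "p = [e]" by (cases p; cases "tl p") auto
    then show False
      by cases (use q(1,2) uv in \<open>auto simp: del_edge_def a\<close>)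
  qed
  have "pcas u (p @ [(v, u)]) u" "pawalk_verts u (p @ [(v, u)]) = pawalk_verts u p @ [u]"
    using q(2) by (rule pcas_snoc, rule pawalk_verts_snoc)
  note snoc = this
  obtain xs where xs: "pawalk_verts u p = u # xs" using q(2) by (cases p) auto
  have "G.awalk u (p @ [(v, u)]) u" using q(1) uv snoc(1) by (auto simp: G.awalk_def del_edge_def)
  moreover have "distinct (tl (pawalk_verts u (p @ [(v, u)])))"
    using q(3) unfolding snoc(2) xs by simp
  ultimately have "G.cycle (p @ [(v, u)])" unfolding G.cycle_def by blast
  then show ?thesis using \<open>2 \<le> length p\<close> by (intro exI[of _ "p @ [(v, u)]"]) simp
qed

text \<open>Every edge being a bridge means that the core has no edges.\<close>

lemma bridge_exts_empty_iff:
  assumes "finite V" "E \<in> simple_arcs V"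
  shows "E \<in> bridge_exts V {} \<longleftrightarrow> bridges V E = E"
proof
  show "bridges V E = E" if "E \<in> bridge_exts V {}"
    using bridge_exts_arc_bridge[OF assms(1) empty_simple that] by (auto simp: bridges_def)
  show "E \<in> bridge_exts V {}" if "bridges V E = E"
    using core_bridgeless[OF assms] that by (simp add: core_def)
qed

lemma graph_of_forest_iff:
  assumes "finite V" "E \<in> simple_arcs V"
  shows "\<not> (\<exists>p. pre_digraph.cycle (with_proj (graph_of V E)) p \<and> 3 \<le> length p) \<longleftrightarrow> E \<in> bridge_exts V {}"
proof -
  have "bridges V E \<subseteq> E" by (auto simp: bridges_def)
  then show ?thesis
    unfolding bridge_exts_empty_iff[OF assms]
    using cycle_arc_not_bridge[OF assms] not_bridge_imp_cycle[OF assms] by blast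
qed

section \<open>Probabilities as ratios of counts, and the final averaging\<close>

lemma graphs_on_eq_image:
  assumes "\<And>G. G \<in> \<A> \<Longrightarrow> pair_graph G"
  shows "graphs_on \<A> n = graph_of {1..n} ` {E \<in> simple_arcs {1..n}. graph_of {1..n} E \<in> \<A>}"
proof -
  have "G \<in> graph_of {1..n} ` {E \<in> simple_arcs {1..n}. graph_of {1..n} E \<in> \<A>}"
    if G: "G \<in> graphs_on \<A> n" for G
  proof -
    have eq: "G = graph_of {1..n} (parcs G)" using G by (simp add: graphs_on_def)
    have "parcs G \<in> simple_arcs {1..n}"
      using G assms[of G] pair_graph_iff[of G] by (simp add: graphs_on_def)
    moreover have "graph_of {1..n} (parcs G) \<in> \<A>"
      using G unfolding eq[symmetric] by (simp add: graphs_on_def)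
    ultimately show ?thesis using eq by blast
  qed
  then show ?thesis by (auto simp: graphs_on_def)
qed

lemma prob_connected_image:
  assumes "\<E> \<subseteq> simple_arcs {1..n}" "\<E> \<noteq> {}" "0 < n"
  shows "prob_connected (graph_of {1..n} ` \<E>) = real (card {E \<in> \<E>. comps {1..n} E = {{1..n}}}) / card \<E>"
proof -
  have fin: "finite \<E>" using assms(1) finite_simple_arcs[of "{1..n}"] finite_subset by blast
  have inj: "inj_on (graph_of {1..n}) X" for X :: "nat rel set" by (rule inj_onI) simp
  have "graph_of {1..n} ` \<E> \<inter> {G. Digraph_Component.connected (with_proj G)} =
      graph_of {1..n} ` {E \<in> \<E>. comps {1..n} E = {{1..n}}}"
    using connected_iff[of "{1..n}"] assms(1,3) by auto
  then show ?thesis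
    unfolding prob_connected_def
    using fin assms(2) by (simp add: measure_pmf_of_set card_image[OF inj] del: One_nat_def)
qed

lemma prob_connected_forests:
  assumes "0 < t"
  shows "prob_connected (graphs_on forests t) =
    real (card (connected_exts {1..t} {})) / card (bridge_exts {1..t} ({} :: nat rel))"
proof -
  have "{E \<in> simple_arcs {1..t}. graph_of {1..t} E \<in> forests} = bridge_exts {1..t} {}"
    using graph_of_forest_iff[of "{1..t}"] bridge_extsD(1)[of _ "{1..t}" "{}"]
    by (auto simp: forests_def pair_graph_iff)
  then have "graphs_on forests t = graph_of {1..t} ` bridge_exts {1..t} {}"
    using graphs_on_eq_image[of forests t] by (simp add: forests_def)
  moreover have "{} \<in> bridge_exts {1..t} {}" by (simp add: bridge_exts_def empty_simple)
  then have "bridge_exts {1..t} {} \<noteq> ({} :: nat rel set)" by blast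
  ultimately show ?thesis
    using prob_connected_image[of "bridge_exts {1..t} {}" t] assms bridge_extsD(1)[of _ "{1..t}" "{}"]
    by (auto simp: connected_exts_def)
qed

theorem theorem1p4:
  fixes \<A> :: "nat pair_pre_digraph set" and n :: nat and \<alpha> :: real
  assumes "\<And>G. G \<in> \<A> \<Longrightarrow> pair_graph G"
    and "bridge_alterable \<A>"
    and "n \<ge> 1"
    and "graphs_on \<A> n \<noteq> {}"
    and "\<alpha> = 0.4"
  shows "prob_connected (graphs_on \<A> n) \<ge>
    (MIN t \<in> {t::nat. \<alpha> * real n \<le> real t \<and> t \<le> n}. prob_connected (graphs_on forests t))"
proof -
  let ?V = "{1..n}"
  let ?T = "{t::nat. \<alpha> * real n \<le> real t \<and> t \<le> n}"
  let ?M = "MIN t \<in> ?T. prob_connected (graphs_on forests t)"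
  define \<E> where "\<E> = {E \<in> simple_arcs ?V. graph_of ?V E \<in> \<A>}"
  have V: "finite ?V" "?V \<noteq> {}" "0 < n" using assms(3) by auto
  have eq: "graphs_on \<A> n = graph_of ?V ` \<E>" unfolding \<E>_def using graphs_on_eq_image[OF assms(1)] by blast
  have ne: "\<E> \<noteq> {}" using assms(4) eq by auto
  have sub: "\<E> \<subseteq> simple_arcs ?V" by (auto simp: \<E>_def)
  have fin: "finite \<E>" using sub finite_simple_arcs[OF V(1)] finite_subset by blast
  have finT: "finite ?T" by (rule finite_subset[of _ "{..n}"]) auto
  \<comment> \<open>Membership in \<open>\<A>\<close> depends only on the core, so the class
    contains each block entirely or not at all. This is the only place where bridge-alterability
    enters.\<close>
  have fiber: "{E \<in> \<E>. core ?V E = H} = bridge_exts ?V H" and H: "H \<in> simple_arcs ?V"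
    if HE: "H \<in> core ?V ` \<E>" for H
  proof -
    obtain E where E: "E \<in> \<E>" "H = core ?V E" using HE by blast
    then have H': "H \<in> simple_arcs ?V" "bridges ?V H = {}"
      using core_bridgeless[OF V(1)] sub by auto
    have "graph_of ?V H \<in> \<A>" using core_mem_iff[OF assms(2) V(1)] E sub by (auto simp: \<E>_def)
    then have "{E \<in> \<E>. core ?V E = H} = {E \<in> simple_arcs ?V. core ?V E = H}"
      using core_mem_iff[OF assms(2) V(1)] by (auto simp: \<E>_def)
    then show "{E \<in> \<E>. core ?V E = H} = bridge_exts ?V H" "H \<in> simple_arcs ?V"
      using core_eq_iff[OF V(1) H'] H'(1) by auto
  qed
  have group: "card {E \<in> \<E>. Q E} = (\<Sum>H\<in>core ?V ` \<E>. card {E \<in> bridge_exts ?V H. Q E})" for Q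
  proof -
    have img: "core ?V ` {E \<in> \<E>. Q E} \<subseteq> core ?V ` \<E>" by blast
    have "card {E \<in> \<E>. Q E} = (\<Sum>H\<in>core ?V ` \<E>. card {E \<in> {E \<in> \<E>. Q E}. core ?V E = H})"
      using sum.group[OF _ _ img, of "\<lambda>_. 1::nat"] fin by simp
    also have "\<dots> = (\<Sum>H\<in>core ?V ` \<E>. card {E \<in> bridge_exts ?V H. Q E})"
    proof (rule sum.cong)
      fix H assume "H \<in> core ?V ` \<E>"
      then have "{E \<in> {E \<in> \<E>. Q E}. core ?V E = H} = {E \<in> bridge_exts ?V H. Q E}"
        using fiber by blast
      then show "card {E \<in> {E \<in> \<E>. Q E}. core ?V E = H} = card {E \<in> bridge_exts ?V H. Q E}" by simp
    qed simp
    finally show ?thesis .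
  qed
  \<comment> \<open>The bound in cross-multiplied form, ready to be summed over the blocks.\<close>
  have le: "?M * real (card (bridge_exts ?V H)) \<le> real (card (connected_exts ?V H))"
    if "H \<in> core ?V ` \<E>" for H
  proof -
    note H = H[OF that]
    obtain t where t: "2 / 5 * real (card ?V) \<le> real t" "t \<le> card ?V" "0 < t"
      "real (card (bridge_exts ?V H)) / card (connected_exts ?V H) \<le>
        real (card (bridge_exts {1..t} {})) / card (connected_exts {1..t} ({} :: nat rel))"
      using bridge_exts_ratio_bound[OF V(1) H V(2)] .
    have "t \<in> ?T" using t(1,2) unfolding assms(5) by simp
    then have "?M \<le> real (card (connected_exts {1..t} {})) / card (bridge_exts {1..t} ({} :: nat rel))"
      using finT prob_connected_forests[OF t(3)] by (metis (mono_tags, lifting) Min_le finite_imageI imageI)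
    moreover have pos: "0 < card (connected_exts ?V H)" "0 < card (connected_exts {1..t} ({} :: nat rel))"
      "0 < card (bridge_exts {1..t} ({} :: nat rel))"
    proof -
      show "0 < card (connected_exts ?V H)" using card_connected_exts_pos[OF V(1) H V(2)] .
      show c: "0 < card (connected_exts {1..t} ({} :: nat rel))"
        using card_connected_exts_pos[OF _ empty_simple, of "{1..t}"] t(3) by simp
      have "connected_exts {1..t} ({} :: nat rel) \<subseteq> bridge_exts {1..t} {}"
        by (auto simp: connected_exts_def)
      then show "0 < card (bridge_exts {1..t} ({} :: nat rel))"
        using c finite_bridge_exts[of "{1..t}"] by (meson card_mono finite_atLeastAtMost le_trans not_le)
    qed
    ultimately have "?M * real (card (bridge_exts ?V H)) \<le>
        real (card (connected_exts {1..t} {})) / card (bridge_exts {1..t} ({} :: nat rel)) *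
          real (card (bridge_exts ?V H))"
      by (intro mult_right_mono) auto
    also have "\<dots> \<le> real (card (connected_exts ?V H))"
      using t(4) pos by (simp add: field_simps)
    finally show ?thesis .
  qed
  have "?M * real (card \<E>) = (\<Sum>H\<in>core ?V ` \<E>. ?M * real (card (bridge_exts ?V H)))"
    using group[of "\<lambda>_. True"] by (simp add: sum_distrib_left)
  also have "\<dots> \<le> (\<Sum>H\<in>core ?V ` \<E>. real (card (connected_exts ?V H)))"
    using le by (rule sum_mono)
  also have "\<dots> = real (card {E \<in> \<E>. comps ?V E = {?V}})"
    using group[of "\<lambda>E. comps ?V E = {?V}"] by (simp add: connected_exts_def)
  finally have "?M \<le> real (card {E \<in> \<E>. comps ?V E = {?V}}) / real (card \<E>)"
    using fin ne by (simp add: le_divide_eq card_gt_0_iff)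
  then show ?thesis unfolding eq prob_connected_image[OF sub ne V(3)] .
qed

end
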